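(* Let $\Gamma_+=\{x\in\mathbb{R}^n: x_i>0\ \forall i\}$ and let $f$ be a smooth symmetric function on $\Gamma_+$ which is monotone increasing in each argument, concave, and inverse-concave (i.e. $f^*(x_1,\dots,x_n)=-f(x_1^{-1},\dots,x_n^{-1})$ is concave on $\Gamma_+$). For a symmetric positive definite $n\times n$ matrix $A$ let $F(A)=f(\lambda(A))$, where $\lambda(A)$ denotes the eigenvalues of $A$. Let $A$ be a symmetric positive definite matrix, let $v\neq 0$ be an eigenvector of $A$ corresponding to its smallest eigenvalue, and let $\varepsilon=\frac{A_{ij}v^iv^j}{\mathrm{tr}(A)\,|v|^2}$, assumed to lie in $(0,1/n)$. Let $T$ be a totally symmetric $3$-tensor on $\mathbb{R}^n$ such that $T_{ijk}v^iv^j=\varepsilon\,\delta^{ij}T_{ijk}$ for $k=1,\dots,n$. Then $$v^iv^j\ddot F^{kl,pq}(A)T_{ikl}T_{jpq}-\varepsilon|v|^2\delta^{ab}\ddot F^{kl,pq}(A)T_{akl}T_{bpq}+2\sup_{\Gamma}\dot F^{kl}(A)\Big(2\Gamma_k^p\big(T_{lpi}v^i-\varepsilon\,\delta^{ab}T_{lab}v_p\big)-\Gamma_k^p\Gamma_l^q\big(A_{pq}-\varepsilon\,\mathrm{tr}(A)\,\delta_{pq}\big)\Big)\ge 0,$$ where the supremum is over all real arrays $(\Gamma_k^p)_{k,p=1}^n$.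
   Context: Repeated indices are summed from $1$ to $n$; indices are raised and lowered with the Euclidean metric $\delta$ (so $v_p=v^p$). $\dot F^{kl}(A)$ and $\ddot F^{kl,pq}(A)$ are the first and second derivatives of $F$ with respect to matrix entries: $\frac{d}{ds}F(A+sB)|_{s=0}=\dot F^{kl}(A)B_{kl}$ and $\frac{d^2}{ds^2}F(A+sB)|_{s=0}=\ddot F^{kl,pq}(A)B_{kl}B_{pq}$ for symmetric $B$. *)

theory Defs
  imports "HOL-Analysis.Analysis"
begin

definition pos_cone :: "(real^'n) set" where
  "pos_cone = {x. \<forall>i. x $ i > 0}"

fun Ck_on :: "nat \<Rightarrow> ('a::euclidean_space) set \<Rightarrow> ('a \<Rightarrow> real) \<Rightarrow> bool" where
  "Ck_on 0 S g = continuous_on S g"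
| "Ck_on (Suc k) S g = (\<exists>g'. (\<forall>x\<in>S. (g has_derivative g' x) (at x)) \<and>
                             (\<forall>w. Ck_on k S (\<lambda>x. g' x w)))"

definition smooth_on :: "('a::euclidean_space) set \<Rightarrow> ('a \<Rightarrow> real) \<Rightarrow> bool" where
  "smooth_on S g \<longleftrightarrow> (\<forall>k. Ck_on k S g)"

definition symmetric_fun :: "(real^'n) set \<Rightarrow> (real^'n \<Rightarrow> real) \<Rightarrow> bool" where
  "symmetric_fun S f \<longleftrightarrow>
     (\<forall>\<sigma> x. \<sigma> permutes (UNIV::'n set) \<and> x \<in> S \<longrightarrow> f (\<chi> i. x $ \<sigma> i) = f x)"

definition incr_each_arg :: "(real^'n) set \<Rightarrow> (real^'n \<Rightarrow> real) \<Rightarrow> bool" where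
  "incr_each_arg S f \<longleftrightarrow>
     (\<forall>x i s t. x \<in> S \<and> (\<chi> j. if j = i then s else x $ j) \<in> S
        \<and> (\<chi> j. if j = i then t else x $ j) \<in> S \<and> s \<le> t
        \<longrightarrow> f (\<chi> j. if j = i then s else x $ j) \<le> f (\<chi> j. if j = i then t else x $ j))"

definition dual_fun :: "(real^'n \<Rightarrow> real) \<Rightarrow> real^'n \<Rightarrow> real" where
  "dual_fun f x = - f (\<chi> i. inverse (x $ i))"

definition diag_mat :: "real^'n \<Rightarrow> real^'n^'n" where
  "diag_mat x = (\<chi> i j. if i = j then x $ i else 0)"

definition symmetric_mat :: "real^'n^'n \<Rightarrow> bool" where
  "symmetric_mat A \<longleftrightarrow> transpose A = A"

definition pos_def :: "real^'n^'n \<Rightarrow> bool" where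
  "pos_def A \<longleftrightarrow> symmetric_mat A \<and> (\<forall>x. x \<noteq> 0 \<longrightarrow> x \<bullet> (A *v x) > 0)"

definition eigvals :: "real^'n^'n \<Rightarrow> real^'n" where
  "eigvals A = (SOME x. \<exists>Q. orthogonal_matrix Q \<and> A = Q ** diag_mat x ** transpose Q)"

definition matF :: "(real^'n \<Rightarrow> real) \<Rightarrow> real^'n^'n \<Rightarrow> real" where
  "matF f A = f (eigvals A)"

text \<open>dot F^{kl}(A) M_{kl}, with dot F^{kl} symmetric in k,l (derivative w.r.t.
  entries of symmetric matrices), so only the symmetric part of M contributes.\<close>
definition dotF :: "(real^'n \<Rightarrow> real) \<Rightarrow> real^'n^'n \<Rightarrow> real^'n^'n \<Rightarrow> real" where
  "dotF f A M = deriv (\<lambda>s. matF f (A + s *\<^sub>R ((1/2) *\<^sub>R (M + transpose M)))) 0"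

text \<open>ddot F^{kl,pq}(A) B_{kl} B_{pq} for symmetric B.\<close>
definition ddotF :: "(real^'n \<Rightarrow> real) \<Rightarrow> real^'n^'n \<Rightarrow> real^'n^'n \<Rightarrow> real" where
  "ddotF f A B = deriv (deriv (\<lambda>s. matF f (A + s *\<^sub>R B))) 0"

definition totally_symmetric :: "('n \<Rightarrow> 'n \<Rightarrow> 'n \<Rightarrow> real) \<Rightarrow> bool" where
  "totally_symmetric T \<longleftrightarrow> (\<forall>i j k. T i j k = T j i k \<and> T i j k = T i k j)"

end

theory Submission
  imports Defs "HOL-Library.Landau_Symbols"
begin

text \<open>
  Diagonalise \<open>A\<close> in some orthonormal basis with eigenvalues \<open>x\<^sub>i\<close> whose \<open>m\<close>-th vector is
  \<open>v / |v|\<close>, so that \<open>x\<^sub>m\<close> is the smallest eigenvalue and \<open>\<epsilon> tr A = x\<^sub>m\<close>. In this basis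
  \<open>D\<^sup>2F(B, B) = \<Sum> f\<^sub>i\<^sub>j B\<^sub>i\<^sub>i B\<^sub>j\<^sub>j + \<Sum>\<^bsub>i \<noteq> j\<^esub> g\<^sub>i\<^sub>j B\<^sub>i\<^sub>j\<^sup>2\<close> with \<open>g\<^sub>i\<^sub>j = (f\<^sub>i - f\<^sub>j) / (x\<^sub>i - x\<^sub>j)\<close>.
  The supremum over \<open>\<Gamma>\<close> is either infinite or equals \<open>\<Sum> f\<^sub>k T\<^sub>k\<^sub>p\<^sub>m\<^sup>2 / (x\<^sub>p - x\<^sub>m)\<close>, and inverse-concavity
  bounds the second derivative in direction \<open>T\<^sub>m\<close> below by \<open>- 2 \<Sum> f\<^sub>k T\<^sub>m\<^sub>k\<^sub>p\<^sup>2 / x\<^sub>p\<close>. The remaining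
  negative term, in \<open>T\<^sub>m\<^sub>m\<^sub>m = \<epsilon> \<Sum> T\<^sub>m\<^sub>a\<^sub>a\<close>, is absorbed by the concavity terms
  \<open>- 2 \<epsilon> g\<^sub>m\<^sub>a T\<^sub>m\<^sub>a\<^sub>a\<^sup>2\<close>, using Cauchy-Schwarz and \<open>\<Sum> (x\<^sub>a - x\<^sub>m) \<le> x\<^sub>m (1 - \<epsilon>) / \<epsilon>\<close>.
  Differentiability at multiple eigenvalues comes from the symmetry of \<open>f\<close>: the eigenvectors of
  \<open>A + s B\<close> mix different eigenspaces of \<open>A\<close> only to order \<open>s\<close>, and within an eigenspace the Hessian
  of \<open>f\<close> is a multiple of the identity plus a constant matrix.
\<close>

subsection \<open>Diagonalisation of symmetric matrices\<close>

lemma symmetric_mat_inner: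
  fixes A :: "real^'n^'n"
  assumes "symmetric_mat A"
  shows "x \<bullet> (A *v y) = (A *v x) \<bullet> y"
  using assms by (metis dot_lmul_matrix symmetric_mat_def transpose_matrix_vector)

text \<open>For small \<open>t\<close> of the right sign a nonzero linear term would dominate the
  quadratic one. This serves as the first-order condition for a maximiser of the Rayleigh
  quotient.\<close>

lemma linear_term_vanishes:
  fixes a b :: real
  assumes "\<And>t. 0 \<le> t * a + t\<^sup>2 * b"
  shows "a = 0"
proof (rule ccontr)
  assume "a \<noteq> 0"
  \<comment> \<open>\<open>d\<close> is a positive upper bound for \<open>b\<close>, and
    \<open>t\<close> below minimises \<open>t * a + t\<^sup>2 * d\<close>.\<close>
  define d where "d = \<bar>b\<bar> + 1"
  define t where "t = - a / (2 * d)"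
  have d: "d > 0" "b \<le> d" by (auto simp: d_def)
  then have "t * a + t\<^sup>2 * b \<le> t * a + t\<^sup>2 * d"
    by (intro add_left_mono mult_left_mono) auto
  also have "\<dots> = - (a\<^sup>2 / (4 * d))"
    using d by (simp add: t_def field_simps power2_eq_square)
  also have "\<dots> < 0"
    using \<open>a \<noteq> 0\<close> d by simp
  finally show False
    using assms[of t] by simp
qed

text \<open>Maximise \<open>x \<bullet> (A *v x)\<close> on the unit sphere of \<open>S\<close>. The
  first variation makes the residual \<open>\<mu> *\<^sub>R u - A *v u\<close> orthogonal to
  \<open>S\<close>; by invariance the residual lies in \<open>S\<close>, so it is zero.\<close>

lemma rayleigh_maximiser_eigenvector:
  fixes A :: "real^'n^'n"
  assumes sym: "symmetric_mat A" and S: "subspace S" "\<And>x. x \<in> S \<Longrightarrow> A *v x \<in> S" and "S \<noteq> {0}"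
  obtains u \<mu> where "u \<in> S" "norm u = 1" "A *v u = \<mu> *\<^sub>R u"
proof -
  have "compact (S \<inter> sphere 0 1)"
    using closed_subspace[OF S(1)] by (simp add: closed_Int_compact)
  moreover have "S \<inter> sphere 0 1 \<noteq> {}"
  proof -
    obtain x where "x \<in> S" "x \<noteq> 0"
      using \<open>S \<noteq> {0}\<close> subspace_0[OF S(1)] by blast
    then have "(1 / norm x) *\<^sub>R x \<in> S \<inter> sphere 0 1"
      using S(1) by (auto simp: subspace_scale)
    then show ?thesis by blast
  qed
  moreover have "continuous_on (S \<inter> sphere 0 1) (\<lambda>x. x \<bullet> (A *v x))"
    by (intro continuous_intros linear_continuous_on matrix_vector_mul_bounded_linear)
  ultimately obtain u where u': "u \<in> S \<inter> sphere 0 1"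
    and max': "\<forall>y\<in>S \<inter> sphere 0 1. y \<bullet> (A *v y) \<le> u \<bullet> (A *v u)"
    using continuous_attains_sup[of "S \<inter> sphere 0 1" "\<lambda>x. x \<bullet> (A *v x)"] by metis
  have u: "u \<in> S" "norm u = 1"
    using u' by auto
  have max: "y \<bullet> (A *v y) \<le> u \<bullet> (A *v u)" if "y \<in> S" "norm y = 1" for y
    using max' that by auto
  define \<mu> where "\<mu> = u \<bullet> (A *v u)"
  have max': "y \<bullet> (A *v y) \<le> \<mu> * (y \<bullet> y)" if "y \<in> S" for y
  proof (cases "y = 0")
    case False
    have "((1 / norm y) *\<^sub>R y) \<bullet> (A *v ((1 / norm y) *\<^sub>R y)) \<le> \<mu>"
      unfolding \<mu>_def using that False S(1) by (intro max) (auto simp: subspace_scale)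
    then have "(y \<bullet> (A *v y)) / (norm y * norm y) \<le> \<mu>"
      by (simp add: matrix_vector_mult_scaleR)
    then show ?thesis
      using False by (simp add: divide_simps dot_square_norm power2_eq_square mult.commute)
  qed simp
  have orth: "(\<mu> *\<^sub>R u - A *v u) \<bullet> w = 0" if "w \<in> S" for w
  proof -
    have "0 \<le> t * (2 * ((\<mu> *\<^sub>R u - A *v u) \<bullet> w)) + t\<^sup>2 * (\<mu> * (w \<bullet> w) - w \<bullet> (A *v w))" for t
    proof -
      have "u + t *\<^sub>R w \<in> S"
        using u(1) that S(1) by (simp add: subspace_add subspace_scale)
      then have "(u + t *\<^sub>R w) \<bullet> (A *v (u + t *\<^sub>R w)) \<le> \<mu> * ((u + t *\<^sub>R w) \<bullet> (u + t *\<^sub>R w))"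
        by (rule max')
      moreover have "u \<bullet> (A *v u) = \<mu>" "u \<bullet> u = 1" "u \<bullet> (A *v w) = (A *v u) \<bullet> w"
        using u(2) symmetric_mat_inner[OF sym, of u w] by (auto simp: \<mu>_def dot_square_norm)
      ultimately show ?thesis
        by (simp add: matrix_vector_right_distrib matrix_vector_mult_scaleR inner_simps
            inner_commute[of w u] inner_commute[of w "A *v u"] algebra_simps power2_eq_square)
    qed
    from linear_term_vanishes[OF this] show ?thesis by simp
  qed
  have "\<mu> *\<^sub>R u - A *v u \<in> S"
    using u(1) S by (simp add: subspace_diff subspace_scale)
  from orth[OF this] have "A *v u = \<mu> *\<^sub>R u" by simp
  with u that show thesis by blast
qed

text \<open>Induction on the dimension: split off one unit eigenvector; its orthogonal complement in
  \<open>S\<close> is again invariant because \<open>A\<close> is symmetric.\<close>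

lemma symmetric_mat_eigenbasis:
  fixes A :: "real^'n^'n"
  assumes sym: "symmetric_mat A" and S: "subspace S" "\<And>x. x \<in> S \<Longrightarrow> A *v x \<in> S"
  shows "\<exists>B. finite B \<and> pairwise orthogonal B \<and> (\<forall>b\<in>B. norm b = 1 \<and> (\<exists>c. A *v b = c *\<^sub>R b)) \<and> span B = S"
  using S
proof (induction "dim S" arbitrary: S rule: less_induct)
  case (less S)
  show ?case
  proof (cases "S = {0}")
    case True
    then show ?thesis by (intro exI[of _ "{}"]) auto
  next
    case False
    then obtain u \<mu> where u: "u \<in> S" "norm u = 1" "A *v u = \<mu> *\<^sub>R u"
      using rayleigh_maximiser_eigenvector[OF sym less.prems] by blast
    define S' where "S' = S \<inter> {x. u \<bullet> x = 0}"
    have S': "subspace S'"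
      unfolding S'_def using less.prems(1) subspace_hyperplane by (rule subspace_inter)
    moreover have "A *v x \<in> S'" if "x \<in> S'" for x
      using that less.prems(2) symmetric_mat_inner[OF sym, of u x] by (simp add: S'_def u(3))
    moreover have "dim S' < dim S"
    proof (rule dim_psubset)
      have "u \<notin> S'"
        using u(2) by (auto simp: S'_def)
      moreover have "S' \<subseteq> S"
        by (auto simp: S'_def)
      ultimately have "S' \<subset> S"
        using u(1) by blast
      then show "span S' \<subset> span S"
        using S' less.prems(1) by (metis span_eq_iff)
    qed
    ultimately obtain B where B: "finite B" "pairwise orthogonal B"
      "\<forall>b\<in>B. norm b = 1 \<and> (\<exists>c. A *v b = c *\<^sub>R b)" "span B = S'"
      using less.hyps[of S'] by blast
    have "orthogonal u b" if "b \<in> B" for b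
      using span_base[OF that] B(4) by (simp add: S'_def orthogonal_def)
    then have "pairwise orthogonal (insert u B)"
      using B(2) by (auto simp: pairwise_insert orthogonal_commute)
    moreover have "span (insert u B) = S"
    proof
      show "span (insert u B) \<subseteq> S"
        using u(1) B(4) span_superset[of B] less.prems(1)
        by (intro span_minimal) (auto simp: S'_def)
      show "S \<subseteq> span (insert u B)"
      proof
        fix x assume "x \<in> S"
        then have "x - (u \<bullet> x) *\<^sub>R u \<in> S'"
          using u less.prems(1) by (simp add: S'_def subspace_diff subspace_scale inner_simps dot_square_norm)
        then show "x \<in> span (insert u B)"
          unfolding B(4)[symmetric] by (auto simp: span_insert)
      qed
    qed
    ultimately show ?thesis
      using B(1,3) u by (intro exI[of _ "insert u B"]) auto
  qed
qed

lemma conjugate_diag_mat_nth: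
  "(Q ** diag_mat x ** transpose Q) $ i $ j = (\<Sum>k\<in>UNIV. Q $ i $ k * x $ k * Q $ j $ k)"
  by (simp add: matrix_matrix_mult_def diag_mat_def transpose_def if_distrib cong: if_cong)

text \<open>A prescribed unit eigenvector is kept as a column, so that \<open>v / |v|\<close> itself
  becomes a basis vector even if its eigenvalue is multiple.\<close>

lemma orthogonal_diagonalisation:
  fixes A :: "real^'n^'n"
  assumes sym: "symmetric_mat A" and u: "norm u = 1" "A *v u = \<mu> *\<^sub>R u"
  obtains Q x i where "orthogonal_matrix Q" "A = Q ** diag_mat x ** transpose Q" "column i Q = u"
proof -
  define S where "S = {x. u \<bullet> x = 0}"
  have S: "subspace S"
    unfolding S_def by (rule subspace_hyperplane)
  moreover have "A *v x \<in> S" if "x \<in> S" for x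
    using that symmetric_mat_inner[OF sym, of u x] by (simp add: S_def u(2))
  ultimately obtain B where B: "finite B" "pairwise orthogonal B"
      "\<forall>b\<in>B. norm b = 1 \<and> (\<exists>c. A *v b = c *\<^sub>R b)" "span B = S"
    using symmetric_mat_eigenbasis[OF sym] by blast
  define C where "C = insert u B"
  have "orthogonal u b" if "b \<in> B" for b
    using span_base[OF that] B(4) by (simp add: S_def orthogonal_def)
  then have orthC: "pairwise orthogonal C"
    using B(2) by (auto simp: C_def pairwise_insert orthogonal_commute)
  have C: "norm b = 1" "\<exists>c. A *v b = c *\<^sub>R b" if "b \<in> C" for b
    using that B(3) u by (auto simp: C_def)
  have "x \<in> span C" for x
  proof -
    have "x - (u \<bullet> x) *\<^sub>R u \<in> S"
      using u by (simp add: S_def inner_simps dot_square_norm)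
    then show ?thesis
      unfolding B(4)[symmetric] C_def by (auto simp: span_insert)
  qed
  then have "span C = UNIV" by blast
  moreover have indep: "independent C"
    using orthC C(1) by (intro pairwise_orthogonal_independent) force+
  ultimately have "card C = CARD('n)"
    using dim_span_eq_card_independent[of C] by simp
  moreover have "finite C"
    using B(1) by (simp add: C_def)
  ultimately obtain e where e: "bij_betw e (UNIV :: 'n set) C"
    using finite_same_card_bij[of "UNIV :: 'n set" C] by auto
  have eC: "e k \<in> C" for k
    using e bij_betwE by blast
  obtain c where c: "A *v e k = c k *\<^sub>R e k" for k
    using C(2)[OF eC] by metis
  have dot: "e i \<bullet> e j = (if i = j then 1 else 0)" for i j
  proof (cases "i = j")
    case True
    then show ?thesis using C(1)[OF eC] by (simp add: dot_square_norm)
  next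
    case False
    then have "e i \<noteq> e j" using e by (auto simp: bij_betw_def inj_on_def)
    then show ?thesis using orthC eC False by (auto simp: pairwise_def orthogonal_def)
  qed
  define Q :: "real^'n^'n" where "Q = (\<chi> i k. e k $ i)"
  have "transpose Q ** Q = mat 1"
    using dot by (simp add: vec_eq_iff matrix_matrix_mult_def transpose_def Q_def mat_def inner_vec_def)
  then have Q: "orthogonal_matrix Q"
    by (simp add: orthogonal_matrix)
  have "A ** Q = Q ** diag_mat (\<chi> k. c k)"
  proof -
    have "(A ** Q) $ i $ k = (A *v e k) $ i" for i k
      by (simp add: matrix_matrix_mult_def matrix_vector_mult_def Q_def)
    then show ?thesis
      by (simp add: vec_eq_iff c matrix_matrix_mult_def diag_mat_def Q_def if_distrib mult.commute cong: if_cong)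
  qed
  then have "A = Q ** diag_mat (\<chi> k. c k) ** transpose Q"
    using Q by (metis matrix_mul_assoc matrix_mul_rid orthogonal_matrix_def)
  moreover obtain i where "e i = u"
    using e by (metis C_def bij_betw_imp_surj_on imageE insertI1)
  then have "column i Q = u"
    by (simp add: column_def Q_def vec_eq_iff)
  ultimately show thesis
    using Q that by blast
qed

lemma symmetric_mat_diagonalisable:
  fixes A :: "real^'n^'n"
  assumes "symmetric_mat A"
  obtains Q x where "orthogonal_matrix Q" "A = Q ** diag_mat x ** transpose Q"
proof -
  have "(UNIV :: (real^'n) set) \<noteq> {0}"
    by (metis UNIV_I axis_eq_0_iff singletonD zero_neq_one)
  then obtain u \<mu> where "norm u = 1" "A *v u = \<mu> *\<^sub>R u"
    using rayleigh_maximiser_eigenvector[OF assms, of UNIV] by auto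
  with orthogonal_diagonalisation[OF assms] that show thesis by metis
qed

section \<open>Entries of orthogonal matrices\<close>

lemma orthogonal_matrix_row_sum:
  fixes W :: "real^'n^'n"
  assumes "orthogonal_matrix W"
  shows "(\<Sum>k\<in>UNIV. W $ i $ k * W $ j $ k) = (if i = j then 1 else 0)"
proof -
  have "(W ** transpose W) $ i $ j = mat 1 $ i $ j"
    using assms by (simp add: orthogonal_matrix_def)
  then show ?thesis
    by (simp add: matrix_matrix_mult_def transpose_def mat_def)
qed

lemma orthogonal_matrix_column_sum:
  fixes W :: "real^'n^'n"
  assumes "orthogonal_matrix W"
  shows "(\<Sum>k\<in>UNIV. W $ k $ i * W $ k $ j) = (if i = j then 1 else 0)"
proof -
  have "orthogonal_matrix (transpose W)"
    using assms by (simp add: orthogonal_matrix_transpose)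
  from orthogonal_matrix_row_sum[OF this, of i j] show ?thesis
    by (simp add: transpose_def)
qed

lemma orthogonal_matrix_entry_le_1:
  fixes W :: "real^'n^'n"
  assumes "orthogonal_matrix W"
  shows "\<bar>W $ i $ j\<bar> \<le> 1"
proof -
  have "(W $ i $ j)\<^sup>2 \<le> (\<Sum>k\<in>UNIV. (W $ i $ k)\<^sup>2)"
    by (rule member_le_sum) auto
  also have "\<dots> = 1"
    using orthogonal_matrix_row_sum[OF assms, of i i] by (simp add: power2_eq_square)
  finally show ?thesis by (simp add: abs_square_le_1)
qed

text \<open>The Leibniz expansion of \<open>det W = \<plusminus>1\<close> has \<open>n!\<close> terms, so one of them is at least \<open>1 / n!\<close>.\<close>

lemma orthogonal_matrix_large_transversal:
  fixes W :: "real^'n^'n"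
  assumes W: "orthogonal_matrix W"
  obtains p where "p permutes UNIV" "\<And>i. 1 / fact CARD('n) \<le> \<bar>W $ i $ p i\<bar>"
proof -
  define P where "P = {p :: 'n \<Rightarrow> 'n. p permutes UNIV}"
  have P: "finite P" "card P = fact CARD('n)" "P \<noteq> {}"
    using card_permutations[of "UNIV :: 'n set" "CARD('n)"] permutes_id[of "UNIV :: 'n set"]
    by (auto simp: P_def finite_permutations simp del: permutes_id)
  have "\<exists>p\<in>P. 1 / fact CARD('n) \<le> \<bar>\<Prod>i\<in>UNIV. W $ i $ p i\<bar>"
  proof (rule ccontr)
    assume "\<not> ?thesis"
    then have *: "\<bar>\<Prod>i\<in>UNIV. W $ i $ p i\<bar> < 1 / fact CARD('n)" if "p \<in> P" for p
      using that by auto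
    have "\<bar>det W\<bar> \<le> (\<Sum>p\<in>P. \<bar>of_int (sign p) * (\<Prod>i\<in>UNIV. W $ i $ p i)\<bar>)"
      unfolding det_def P_def by (rule sum_abs)
    also have "\<dots> = (\<Sum>p\<in>P. \<bar>\<Prod>i\<in>UNIV. W $ i $ p i\<bar>)"
      by (intro sum.cong) (auto simp: abs_mult sign_def)
    also have "\<dots> < (\<Sum>p\<in>P. 1 / fact CARD('n))"
      using P * by (intro sum_strict_mono) auto
    also have "\<dots> = 1"
      by (simp add: P(2))
    finally show False
      using det_orthogonal_matrix[OF W] by auto
  qed
  then obtain p where p: "p \<in> P" "1 / fact CARD('n) \<le> \<bar>\<Prod>i\<in>UNIV. W $ i $ p i\<bar>"
    by blast
  have "1 / fact CARD('n) \<le> \<bar>W $ i $ p i\<bar>" for i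
  proof -
    have "\<bar>\<Prod>i\<in>UNIV. W $ i $ p i\<bar> = \<bar>W $ i $ p i\<bar> * (\<Prod>j\<in>UNIV - {i}. \<bar>W $ j $ p j\<bar>)"
      by (simp add: prod.remove[of UNIV i] abs_mult abs_prod)
    also have "\<dots> \<le> \<bar>W $ i $ p i\<bar> * 1"
      by (intro mult_left_mono prod_le_1) (auto simp: orthogonal_matrix_entry_le_1[OF W])
    finally show ?thesis using p(2) by simp
  qed
  with p(1) that show thesis by (auto simp: P_def)
qed

section \<open>Independence of \<open>matF\<close> from the chosen diagonalisation\<close>

lemma diag_mat_mult_nth:
  "(diag_mat x ** M) $ i $ j = x $ i * M $ i $ j"
  "(M ** diag_mat x) $ i $ j = M $ i $ j * x $ j"
  by (simp_all add: matrix_matrix_mult_def diag_mat_def if_distrib if_distribR cong: if_cong)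

text \<open>\<open>eigvals\<close> picks an arbitrary diagonalisation. Two of them differ by an
  orthogonal \<open>W\<close> with \<open>y $ i * W $ i $ j = W $ i $ j * x $ j\<close>; a
  transversal of nonzero entries of \<open>W\<close> exhibits \<open>y\<close> as a permutation of
  \<open>x\<close>, which does not change \<open>f\<close>.\<close>

lemma matF_conjugate_diag_mat:
  fixes f :: "real^'n \<Rightarrow> real"
  assumes f: "symmetric_fun pos_cone f" and x: "x \<in> pos_cone" and Q: "orthogonal_matrix Q"
  shows "matF f (Q ** diag_mat x ** transpose Q) = f x"
proof -
  define A where "A = Q ** diag_mat x ** transpose Q"
  define y where "y = eigvals A"
  have "\<exists>x Q. orthogonal_matrix Q \<and> A = Q ** diag_mat x ** transpose Q"
    using Q A_def by blast
  then have "\<exists>Q. orthogonal_matrix Q \<and> A = Q ** diag_mat y ** transpose Q"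
    unfolding y_def eigvals_def by (rule someI_ex)
  then obtain R where R: "orthogonal_matrix R" "A = R ** diag_mat y ** transpose R"
    by blast
  define W where "W = transpose R ** Q"
  have W: "orthogonal_matrix W"
    unfolding W_def using Q R(1) by (intro orthogonal_matrix_mul) (simp_all add: orthogonal_matrix_transpose)
  have "transpose R ** A ** Q = diag_mat y ** W"
    using R unfolding W_def orthogonal_matrix_def by (metis matrix_mul_assoc matrix_mul_lid)
  moreover have "transpose R ** A ** Q = W ** diag_mat x"
    using Q unfolding W_def A_def orthogonal_matrix_def by (metis matrix_mul_assoc matrix_mul_rid)
  ultimately have "y $ i * W $ i $ j = W $ i $ j * x $ j" for i j
    by (metis diag_mat_mult_nth)
  then have *: "W $ i $ j \<noteq> 0 \<Longrightarrow> y $ i = x $ j" for i j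
    by (metis mult.commute mult_left_cancel)
  obtain p where p: "p permutes UNIV" "\<And>i. 1 / fact CARD('n) \<le> \<bar>W $ i $ p i\<bar>"
    using orthogonal_matrix_large_transversal[OF W] by blast
  have "W $ i $ p i \<noteq> 0" for i
    using p(2)[of i] by (auto simp: field_simps)
  then have "y = (\<chi> i. x $ p i)"
    using * by (simp add: vec_eq_iff)
  then have "f y = f x"
    using f p(1) x by (auto simp: symmetric_fun_def)
  then show ?thesis
    by (simp add: matF_def y_def A_def)
qed

lemma symmetric_mat_nth: "symmetric_mat A \<longleftrightarrow> (\<forall>i j. A $ i $ j = A $ j $ i)"
  by (auto simp: symmetric_mat_def transpose_def vec_eq_iff)

subsection \<open>Perturbation of eigenvalues and eigenvectors\<close>

text \<open>Each entry of the eigenvector equation bounds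
  \<open>\<bar>x $ i - z $ k\<bar> * \<bar>U $ i $ k\<bar>\<close> by a multiple of
  \<open>\<bar>s\<bar>\<close>. Relabelling the eigenvalues along a transversal of entries of size
  at least \<open>1 / n!\<close> turns this into a Lipschitz bound that is uniform in
  \<open>s\<close> and valid for multiple eigenvalues.\<close>

lemma diagonal_perturbation:
  fixes x :: "real^'n" and B :: "real^'n^'n"
  assumes B: "symmetric_mat B"
  obtains C where "\<And>s. \<exists>W y. orthogonal_matrix W \<and>
      diag_mat x + s *\<^sub>R B = W ** diag_mat y ** transpose W \<and>
      (\<forall>i. \<bar>y $ i - x $ i\<bar> \<le> C * \<bar>s\<bar>) \<and> (\<forall>i k. \<bar>x $ i - x $ k\<bar> * \<bar>W $ i $ k\<bar> \<le> C * \<bar>s\<bar>)"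
proof -
  define K where "K = (\<Sum>i\<in>UNIV. \<Sum>j\<in>UNIV. \<bar>B $ i $ j\<bar>)"
  define N :: real where "N = fact CARD('n)"
  have K: "K \<ge> 0" and N: "N \<ge> 1"
    by (auto simp: K_def N_def intro!: sum_nonneg)
  have "\<exists>W y. orthogonal_matrix W \<and> diag_mat x + s *\<^sub>R B = W ** diag_mat y ** transpose W \<and>
      (\<forall>i. \<bar>y $ i - x $ i\<bar> \<le> (N * K + K) * \<bar>s\<bar>) \<and>
      (\<forall>i k. \<bar>x $ i - x $ k\<bar> * \<bar>W $ i $ k\<bar> \<le> (N * K + K) * \<bar>s\<bar>)" for s
  proof -
    have "symmetric_mat (diag_mat x + s *\<^sub>R B)"
      using B by (auto simp: symmetric_mat_nth diag_mat_def)
    then obtain U z where U: "orthogonal_matrix U" "diag_mat x + s *\<^sub>R B = U ** diag_mat z ** transpose U"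
      using symmetric_mat_diagonalisable by blast
    have "(diag_mat x + s *\<^sub>R B) ** U = U ** diag_mat z"
      using U by (metis matrix_mul_assoc matrix_mul_rid orthogonal_matrix_def)
    then have *: "x $ i * U $ i $ k + s * (B ** U) $ i $ k = U $ i $ k * z $ k" for i k
      unfolding diag_mat_mult_nth[symmetric] vec_eq_iff
      by (simp add: matrix_matrix_mult_def sum.distrib sum_distrib_left distrib_right mult.assoc)
    have gap: "\<bar>x $ i - z $ k\<bar> * \<bar>U $ i $ k\<bar> \<le> K * \<bar>s\<bar>" for i k
    proof -
      have "\<bar>(B ** U) $ i $ k\<bar> \<le> (\<Sum>j\<in>UNIV. \<bar>B $ i $ j * U $ j $ k\<bar>)"
        by (simp add: matrix_matrix_mult_def)
      also have "\<dots> \<le> (\<Sum>j\<in>UNIV. \<bar>B $ i $ j\<bar>)"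
        using orthogonal_matrix_entry_le_1[OF U(1)]
        by (intro sum_mono) (simp add: abs_mult mult_left_le)
      also have "\<dots> \<le> K"
        unfolding K_def
        by (rule member_le_sum[where f = "\<lambda>i. \<Sum>j\<in>UNIV. \<bar>B $ i $ j\<bar>"]) (auto intro: sum_nonneg)
      finally have "\<bar>s * (B ** U) $ i $ k\<bar> \<le> K * \<bar>s\<bar>"
        by (simp add: abs_mult mult.commute[of K] mult_left_mono)
      moreover have "(x $ i - z $ k) * U $ i $ k = - (s * (B ** U) $ i $ k)"
        using *[of i k] by (simp add: algebra_simps)
      ultimately show ?thesis
        by (metis abs_minus_cancel abs_mult)
    qed
    \<comment> \<open>The perturbed eigenvalue \<open>z $ p i\<close> is matched with
      \<open>x $ i\<close>, because its eigenvector has a component of size at least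
      \<open>1 / N\<close> along axis \<open>i\<close>.\<close>
    obtain p where p: "p permutes UNIV" "\<And>i. 1 / N \<le> \<bar>U $ i $ p i\<bar>"
      using orthogonal_matrix_large_transversal[OF U(1)] unfolding N_def by blast
    have bij: "bij p"
      using p(1) by (simp add: permutes_bij)
    define y where "y = (\<chi> i. z $ p i)"
    define W where "W = (\<chi> i k. U $ i $ p k)"
    have reindex: "(\<Sum>k\<in>UNIV. h (p k)) = (\<Sum>k\<in>UNIV. h k)" for h :: "'n \<Rightarrow> real"
      using sum.reindex_bij_betw[OF bij] by simp
    have "W ** transpose W = mat 1"
      using orthogonal_matrix_row_sum[OF U(1)] reindex[of "\<lambda>k. U $ i $ k * U $ j $ k" for i j]
      by (simp add: vec_eq_iff matrix_matrix_mult_def transpose_def mat_def W_def)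
    then have W: "orthogonal_matrix W"
      by (metis matrix_left_right_inverse orthogonal_matrix_def)
    have "diag_mat x + s *\<^sub>R B = W ** diag_mat y ** transpose W"
      using reindex[of "\<lambda>k. U $ i $ k * z $ k * U $ j $ k" for i j]
      by (simp add: U(2) vec_eq_iff conjugate_diag_mat_nth W_def y_def)
    moreover have dist: "\<bar>y $ i - x $ i\<bar> \<le> N * K * \<bar>s\<bar>" for i
    proof -
      have "\<bar>y $ i - x $ i\<bar> * (1 / N) \<le> \<bar>x $ i - z $ p i\<bar> * \<bar>U $ i $ p i\<bar>"
        unfolding y_def using p(2) N by (intro mult_mono) auto
      also have "\<dots> \<le> K * \<bar>s\<bar>" by (rule gap)
      finally show ?thesis
        using N by (simp add: field_simps)
    qed
    moreover have "\<bar>x $ i - x $ k\<bar> * \<bar>W $ i $ k\<bar> \<le> (N * K + K) * \<bar>s\<bar>" for i k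
    proof -
      have "\<bar>x $ i - x $ k\<bar> * \<bar>W $ i $ k\<bar> \<le> (\<bar>x $ i - y $ k\<bar> + \<bar>y $ k - x $ k\<bar>) * \<bar>W $ i $ k\<bar>"
        by (intro mult_right_mono) auto
      also have "\<dots> = \<bar>x $ i - z $ p k\<bar> * \<bar>U $ i $ p k\<bar> + \<bar>y $ k - x $ k\<bar> * \<bar>W $ i $ k\<bar>"
        by (simp add: y_def W_def algebra_simps)
      also have "\<dots> \<le> K * \<bar>s\<bar> + N * K * \<bar>s\<bar> * 1"
        using N K by (intro add_mono gap mult_mono dist orthogonal_matrix_entry_le_1[OF W]) auto
      finally show ?thesis by (simp add: algebra_simps)
    qed
    moreover have "N * K * \<bar>s\<bar> \<le> (N * K + K) * \<bar>s\<bar>"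
      using K by (simp add: mult_right_mono)
    ultimately show ?thesis
      using W by (meson order_trans)
  qed
  then show thesis by (rule that)
qed

section \<open>Landau calculus for perturbed eigenvalues and eigenvectors\<close>

lemma square_smallo_at_0: "(\<lambda>s::real. s * s) \<in> o[at 0](\<lambda>s. s)"
proof (rule smalloI_tendsto)
  have "((\<lambda>s::real. s) \<longlongrightarrow> 0) (at 0)" by (rule tendsto_ident_at)
  moreover have "eventually (\<lambda>s::real. s = s * s / s) (at 0)"
    by (auto simp: eventually_at_filter)
  ultimately show "((\<lambda>s::real. s * s / s) \<longlongrightarrow> 0) (at 0)"
    by (rule Lim_transform_eventually)
  show "\<forall>\<^sub>F s::real in at 0. s \<noteq> 0"
    by (auto simp: eventually_at_filter)
qed

lemma bigo_square_imp_smallo: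
  "h \<in> O[at 0](\<lambda>s::real. s * s) \<Longrightarrow> h \<in> o[at 0](\<lambda>s. s)"
  by (rule landau_o.big_small_trans[OF _ square_smallo_at_0])

text \<open>The diagonalisation is chosen separately for each \<open>s\<close>. No continuity in
  \<open>s\<close> is assumed inside a multiple eigenspace, where the eigenvectors may jump; only
  the mixing of different eigenspaces is controlled.\<close>

locale eigen_perturbation =
  fixes x :: "real^'n" and B :: "real^'n^'n" and W :: "real \<Rightarrow> real^'n^'n" and y :: "real \<Rightarrow> real^'n"
  assumes orth: "orthogonal_matrix (W s)"
    and diagonalise: "diag_mat x + s *\<^sub>R B = W s ** diag_mat (y s) ** transpose (W s)"
    and y_bigo: "(\<lambda>s. y s $ i - x $ i) \<in> O[at 0](\<lambda>s. s)"
    and W_bigo: "x $ i \<noteq> x $ k \<Longrightarrow> (\<lambda>s. W s $ i $ k) \<in> O[at 0](\<lambda>s. s)"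
begin

lemma W_bigo_1: "(\<lambda>s. W s $ i $ k) \<in> O[at 0](\<lambda>_. 1)"
  by (rule bigoI[of _ 1]) (simp add: orthogonal_matrix_entry_le_1[OF orth])

lemma WW_bigo_1: "(\<lambda>s. W s $ i $ k * W s $ j $ k) \<in> O[at 0](\<lambda>_. 1)"
  using landau_o.big.mult[OF W_bigo_1 W_bigo_1] by simp

lemma WW_bigo:
  assumes "x $ i \<noteq> x $ k \<or> x $ j \<noteq> x $ k"
  shows "(\<lambda>s. W s $ i $ k * W s $ j $ k) \<in> O[at 0](\<lambda>s. s)"
  using assms landau_o.big.mult[OF W_bigo W_bigo_1, of i k j k]
    landau_o.big.mult[OF W_bigo_1 W_bigo, of j k i k] by auto

lemma WW_bigo_square:
  assumes "x $ i \<noteq> x $ k" "x $ j \<noteq> x $ k"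
  shows "(\<lambda>s. W s $ i $ k * W s $ j $ k) \<in> O[at 0](\<lambda>s. s * s)"
  using landau_o.big.mult[OF W_bigo[OF assms(1)] W_bigo[OF assms(2)]] .

lemma y_bigo_1: "(\<lambda>s. y s $ i - c) \<in> O[at 0](\<lambda>_. 1)"
proof -
  have "(\<lambda>s::real. s) \<in> O[at 0](\<lambda>_. 1 :: real)"
    by (rule bigoI_tendsto[where c = 0]) (auto intro!: tendsto_eq_intros)
  from landau_o.big_trans[OF y_bigo this]
  have "(\<lambda>s. (y s $ i - x $ i) + (x $ i - c)) \<in> O[at 0](\<lambda>_. 1)"
    by (rule sum_in_bigo) simp
  then show ?thesis by simp
qed

lemma sum_WW: "(\<Sum>k\<in>UNIV. W s $ i $ k * W s $ j $ k) = (if i = j then 1 else 0)"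
  by (rule orthogonal_matrix_row_sum[OF orth])

lemma sum_WW_y:
  "(\<Sum>k\<in>UNIV. W s $ i $ k * W s $ j $ k * (y s $ k - c)) = (if i = j then x $ i - c else 0) + s * B $ i $ j"
proof -
  have "(\<Sum>k\<in>UNIV. W s $ i $ k * y s $ k * W s $ j $ k) = (diag_mat x + s *\<^sub>R B) $ i $ j"
    unfolding diagonalise by (simp add: conjugate_diag_mat_nth)
  moreover have "(\<Sum>k\<in>UNIV. W s $ i $ k * W s $ j $ k * (y s $ k - c)) =
      (\<Sum>k\<in>UNIV. W s $ i $ k * y s $ k * W s $ j $ k) - c * (\<Sum>k\<in>UNIV. W s $ i $ k * W s $ j $ k)"
    by (simp add: sum_subtractf sum_distrib_left algebra_simps)
  ultimately show ?thesis
    by (auto simp: sum_WW diag_mat_def)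
qed

text \<open>With the squares of \<open>W s $ i $ k\<close> as weights, the difference becomes one
  double sum whose terms vanish exactly inside a block of equal entries of \<open>x\<close>. Between
  blocks the weight is O(s^2).\<close>

lemma block_trace:
  assumes c: "\<And>k l. x $ k = x $ l \<Longrightarrow> c k = c l"
  shows "(\<lambda>s. (\<Sum>k\<in>UNIV. c k * (y s $ k - x $ k)) - s * (\<Sum>k\<in>UNIV. c k * B $ k $ k))
    \<in> O[at 0](\<lambda>s. s * s)"
proof -
  have eq: "(\<Sum>k\<in>UNIV. c k * (y s $ k - x $ k)) - s * (\<Sum>k\<in>UNIV. c k * B $ k $ k) =
      (\<Sum>i\<in>UNIV. \<Sum>k\<in>UNIV. W s $ i $ k * W s $ i $ k *
          (c k * (y s $ k - x $ k) - c i * (y s $ k - x $ i)))" for s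
  proof -
    have "(\<Sum>k\<in>UNIV. c k * (y s $ k - x $ k)) =
        (\<Sum>k\<in>UNIV. (\<Sum>i\<in>UNIV. W s $ i $ k * W s $ i $ k) * (c k * (y s $ k - x $ k)))"
      by (simp add: orthogonal_matrix_column_sum[OF orth])
    also have "\<dots> = (\<Sum>i\<in>UNIV. \<Sum>k\<in>UNIV. W s $ i $ k * W s $ i $ k * (c k * (y s $ k - x $ k)))"
      unfolding sum_distrib_right by (rule sum.swap)
    finally have 1: "(\<Sum>k\<in>UNIV. c k * (y s $ k - x $ k)) = \<dots>" .
    have "s * (\<Sum>k\<in>UNIV. c k * B $ k $ k) =
        (\<Sum>i\<in>UNIV. c i * (\<Sum>k\<in>UNIV. W s $ i $ k * W s $ i $ k * (y s $ k - x $ i)))"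
      by (simp only: sum_WW_y) (simp add: sum_distrib_left mult_ac)
    also have "\<dots> = (\<Sum>i\<in>UNIV. \<Sum>k\<in>UNIV. W s $ i $ k * W s $ i $ k * (c i * (y s $ k - x $ i)))"
      by (simp add: sum_distrib_left mult_ac)
    finally have 2: "s * (\<Sum>k\<in>UNIV. c k * B $ k $ k) = \<dots>" .
    show ?thesis
      unfolding 1 2 by (simp only: sum_subtractf[symmetric] right_diff_distrib[symmetric])
  qed
  have bound: "(\<lambda>s. W s $ i $ k * W s $ i $ k * (c k * (y s $ k - x $ k) - c i * (y s $ k - x $ i)))
      \<in> O[at 0](\<lambda>s. s * s)" for i k
  proof (cases "x $ i = x $ k")
    case True
    then show ?thesis using c[OF True] by simp
  next
    case False
    have "(\<lambda>s. c k * (y s $ k - x $ k) - c i * (y s $ k - x $ i)) \<in> O[at 0](\<lambda>_. 1)"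
      by (intro sum_in_bigo landau_o.big.mult_in_1 y_bigo_1) simp_all
    from landau_o.big.mult[OF WW_bigo_square[OF False False] this] show ?thesis by simp
  qed
  show ?thesis
    unfolding eq by (intro big_sum_in_bigo bound)
qed

text \<open>For \<open>k\<close> outside the common block both \<open>W s $ i $ k\<close> and
  \<open>W s $ j $ k\<close> are O(s); inside it \<open>c k - c i\<close> vanishes.\<close>

lemma projection_same_block:
  assumes c: "\<And>k l. x $ k = x $ l \<Longrightarrow> c k = c l" and ij: "x $ i = x $ j"
  shows "(\<lambda>s. (\<Sum>k\<in>UNIV. W s $ i $ k * W s $ j $ k * c k) - (if i = j then c i else 0)) \<in> O[at 0](\<lambda>s. s * s)"
proof -
  have eq: "(\<Sum>k\<in>UNIV. W s $ i $ k * W s $ j $ k * c k) - (if i = j then c i else 0) =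
      (\<Sum>k\<in>UNIV. W s $ i $ k * W s $ j $ k * (c k - c i))" for s
    using arg_cong[OF sum_WW[of s i j], of "\<lambda>u. c i * u"]
    by (auto simp: sum_subtractf sum_distrib_left algebra_simps)
  have bound: "(\<lambda>s. W s $ i $ k * W s $ j $ k * (c k - c i)) \<in> O[at 0](\<lambda>s. s * s)" for k
  proof (cases "x $ i = x $ k")
    case True
    then show ?thesis using c[OF True] by simp
  next
    case False
    have "(\<lambda>s. c k - c i) \<in> O[at 0](\<lambda>_. 1)" by simp
    from landau_o.big.mult[OF WW_bigo_square[of i k j] this] show ?thesis using False ij by simp
  qed
  show ?thesis
    unfolding eq by (intro big_sum_in_bigo bound)
qed

text \<open>With base point \<open>x $ i\<close> the sum is exactly \<open>s * B $ i $ j\<close> by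
  \<open>sum_WW_y\<close>. Moving the base point to \<open>x $ k\<close> affects only terms outside
  the block, which are O(s^2).\<close>

lemma eigenvalue_shift_same_block:
  assumes ij: "x $ i = x $ j"
  shows "(\<lambda>s. (\<Sum>k\<in>UNIV. W s $ i $ k * W s $ j $ k * (y s $ k - x $ k)) - s * B $ i $ j) \<in> O[at 0](\<lambda>s. s * s)"
proof -
  have eq: "(\<Sum>k\<in>UNIV. W s $ i $ k * W s $ j $ k * (y s $ k - x $ k)) - s * B $ i $ j =
      (\<Sum>k\<in>UNIV. W s $ i $ k * W s $ j $ k * (x $ i - x $ k))" for s
    using sum_WW_y[of s i j "x $ i"] by (simp add: sum_subtractf algebra_simps)
  have bound: "(\<lambda>s. W s $ i $ k * W s $ j $ k * (x $ i - x $ k)) \<in> O[at 0](\<lambda>s. s * s)" for k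
  proof (cases "x $ i = x $ k")
    case False
    have "(\<lambda>s. x $ i - x $ k) \<in> O[at 0](\<lambda>_. 1)" by simp
    from landau_o.big.mult[OF WW_bigo_square[of i k j] this] show ?thesis using False ij by simp
  qed simp
  show ?thesis
    unfolding eq by (intro big_sum_in_bigo bound)
qed

text \<open>Take the affine function with slope \<open>g\<close> that interpolates \<open>c\<close>
  at \<open>x $ i\<close> and \<open>x $ j\<close>. Evaluated at the perturbed eigenvalues it
  contributes exactly the first-order term, and the remainder is O(s^2) for every
  \<open>k\<close>.\<close>

lemma projection_different_block:
  assumes c: "\<And>k l. x $ k = x $ l \<Longrightarrow> c k = c l" and ij: "x $ i \<noteq> x $ j"
  shows "(\<lambda>s. (\<Sum>k\<in>UNIV. W s $ i $ k * W s $ j $ k * c k) - s * ((c i - c j) / (x $ i - x $ j) * B $ i $ j))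
    \<in> O[at 0](\<lambda>s. s * s)"
proof -
  define g where "g = (c i - c j) / (x $ i - x $ j)"
  have g: "g * (x $ i - x $ j) = c i - c j"
    using ij by (simp add: g_def)
  have eq: "(\<Sum>k\<in>UNIV. W s $ i $ k * W s $ j $ k * c k) - s * (g * B $ i $ j) =
      (\<Sum>k\<in>UNIV. W s $ i $ k * W s $ j $ k * (c k - c j - g * (y s $ k - x $ j)))" (is "?l = ?r") for s
  proof -
    have "?r = (\<Sum>k\<in>UNIV. W s $ i $ k * W s $ j $ k * c k)
        - c j * (\<Sum>k\<in>UNIV. W s $ i $ k * W s $ j $ k)
        - g * (\<Sum>k\<in>UNIV. W s $ i $ k * W s $ j $ k * (y s $ k - x $ j))"
      by (simp add: sum_subtractf sum.distrib sum_distrib_left algebra_simps)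
    then show ?thesis
      using ij by (auto simp: sum_WW sum_WW_y)
  qed
  have bound: "(\<lambda>s. W s $ i $ k * W s $ j $ k * (c k - c j - g * (y s $ k - x $ j))) \<in> O[at 0](\<lambda>s. s * s)" for k
  \<comment> \<open>In these two blocks the interpolation is exact at \<open>x $ k\<close>, so
    remainder and weight are each O(s); in any other block the weight alone is O(s^2).\<close>
  proof (cases "x $ k = x $ i \<or> x $ k = x $ j")
    case True
    then have *: "c k - c j - g * (y s $ k - x $ j) = - g * (y s $ k - x $ k)" for s
      using g c[of k i] c[of k j] by (auto simp: algebra_simps)
    have "(\<lambda>s. - g * (y s $ k - x $ k)) \<in> O[at 0](\<lambda>s. s)"
      using y_bigo by (cases "g = 0") auto
    moreover have "(\<lambda>s. W s $ i $ k * W s $ j $ k) \<in> O[at 0](\<lambda>s. s)"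
      using True ij by (intro WW_bigo) auto
    ultimately show ?thesis
      unfolding * by (rule landau_o.big.mult[rotated])
  next
    case False
    have "(\<lambda>s. c k - c j - g * (y s $ k - x $ j)) \<in> O[at 0](\<lambda>_. 1)"
      by (intro sum_in_bigo landau_o.big.mult_in_1 y_bigo_1) simp_all
    from landau_o.big.mult[OF WW_bigo_square[of i k j] this] show ?thesis using False by simp
  qed
  show ?thesis
    unfolding g_def[symmetric] eq by (intro big_sum_in_bigo bound)
qed

end

text \<open>When \<open>r s k\<close> is the \<open>k\<close>-th partial derivative of
  \<open>f\<close> at \<open>y s\<close>, the sum is the \<open>(i, j)\<close> entry of the gradient
  of \<open>matF\<close> in the unperturbed eigenbasis; its first-order term yields the second
  derivative. The shape of \<open>H\<close> is the block structure that symmetry of \<open>f\<close>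
  enforces.\<close>

lemma (in eigen_perturbation) second_order_expansion:
  fixes D :: "real^'n" and H :: "real^'n^'n"
  assumes r: "\<And>k. (\<lambda>s. r s k - D $ k - (\<Sum>l\<in>UNIV. H $ k $ l * (y s $ l - x $ l))) \<in> o[at 0](\<lambda>s. s)"
    and D: "\<And>k l. x $ k = x $ l \<Longrightarrow> D $ k = D $ l"
    and H: "\<And>k l. H $ k $ l = K k l + (if k = l then d k else 0)"
    and K1: "\<And>k k' l. x $ k = x $ k' \<Longrightarrow> K k l = K k' l"
    and K2: "\<And>k l l'. x $ l = x $ l' \<Longrightarrow> K k l = K k l'"
    and d: "\<And>k l. x $ k = x $ l \<Longrightarrow> d k = d l"
  shows "(\<lambda>s. (\<Sum>k\<in>UNIV. W s $ i $ k * W s $ j $ k * r s k) - (if i = j then D $ i else 0)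
      - s * (if i = j then \<Sum>l\<in>UNIV. H $ i $ l * B $ l $ l
             else (if x $ i = x $ j then d i else (D $ i - D $ j) / (x $ i - x $ j)) * B $ i $ j))
    \<in> o[at 0](\<lambda>s. s)"
proof -
  \<comment> \<open>\<open>e\<close> is the first-order effect of the part \<open>K\<close>, which
    sees only block traces of \<open>B\<close>. What remains of \<open>r\<close> after removing this
    and the part \<open>d\<close> is \<open>\<rho>\<close>.\<close>
  define e where "e k = (\<Sum>l\<in>UNIV. K k l * B $ l $ l)" for k
  define \<rho> where "\<rho> s k = r s k - D $ k - s * e k - d k * (y s $ k - x $ k)" for s k
  have Hsum: "(\<Sum>l\<in>UNIV. H $ k $ l * u l) = (\<Sum>l\<in>UNIV. K k l * u l) + d k * u k" for u k
    unfolding H distrib_right sum.distrib by (simp add: mult_delta_left)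
  have \<rho>: "(\<lambda>s. \<rho> s k) \<in> o[at 0](\<lambda>s. s)" for k
  proof -
    have "(\<lambda>s. (\<Sum>l\<in>UNIV. K k l * (y s $ l - x $ l)) - s * e k) \<in> o[at 0](\<lambda>s. s)"
      unfolding e_def by (rule bigo_square_imp_smallo[OF block_trace[OF K2]])
    from sum_in_smallo(1)[OF r[of k] this]
    have *: "(\<lambda>s. r s k - D $ k - (\<Sum>l\<in>UNIV. H $ k $ l * (y s $ l - x $ l))
        + ((\<Sum>l\<in>UNIV. K k l * (y s $ l - x $ l)) - s * e k)) \<in> o[at 0](\<lambda>s. s)" .
    have eq: "r s k - D $ k - (\<Sum>l\<in>UNIV. H $ k $ l * (y s $ l - x $ l))
        + ((\<Sum>l\<in>UNIV. K k l * (y s $ l - x $ l)) - s * e k) = \<rho> s k" for s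
      unfolding \<rho>_def Hsum by linarith
    show ?thesis
      using * unfolding eq .
  qed
  have e: "e k = e l" if "x $ k = x $ l" for k l
    using K1[OF that] by (simp add: e_def)
  let ?P = "\<lambda>s c. \<Sum>k\<in>UNIV. W s $ i $ k * W s $ j $ k * c k"
  have split: "?P s (r s) = ?P s (\<lambda>k. D $ k) + s * ?P s e + ?P s (\<lambda>k. d k * (y s $ k - x $ k)) + ?P s (\<rho> s)" for s
    unfolding sum_distrib_left sum.distrib[symmetric]
    by (rule sum.cong) (auto simp: \<rho>_def algebra_simps)
  have P\<rho>: "(\<lambda>s. ?P s (\<rho> s)) \<in> o[at 0](\<lambda>s. s)"
    using landau_o.big_small_mult[OF WW_bigo_1 \<rho>] by (intro big_sum_in_smallo) simp
  show ?thesis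
  proof (cases "x $ i = x $ j")
    case True
    have 1: "(\<lambda>s. ?P s (\<lambda>k. D $ k) - (if i = j then D $ i else 0)) \<in> o[at 0](\<lambda>s. s)"
      by (rule bigo_square_imp_smallo[OF projection_same_block[OF D True]])
    have "(\<lambda>s. ?P s e - (if i = j then e i else 0)) \<in> o[at 0](\<lambda>s. s)"
      by (rule bigo_square_imp_smallo[OF projection_same_block[OF e True]])
    then have "(\<lambda>s. s * (?P s e - (if i = j then e i else 0))) \<in> o[at 0](\<lambda>s. s * s)"
      by (rule landau_o.big_small_mult[rotated]) simp
    then have 2: "(\<lambda>s. s * (?P s e - (if i = j then e i else 0))) \<in> o[at 0](\<lambda>s. s)"
      by (rule bigo_square_imp_smallo[OF landau_o.small_imp_big])
    have 3: "(\<lambda>s. ?P s (\<lambda>k. d k * (y s $ k - x $ k)) - s * (d i * B $ i $ j)) \<in> o[at 0](\<lambda>s. s)"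
    proof -
      have "(\<lambda>s. W s $ i $ k * W s $ j $ k * ((d k - d i) * (y s $ k - x $ k))) \<in> o[at 0](\<lambda>s. s)" for k
      proof (cases "x $ k = x $ i")
        case True
        then show ?thesis using d[OF True] by simp
      next
        case False
        have "(\<lambda>s. (d k - d i) * (y s $ k - x $ k)) \<in> O[at 0](\<lambda>_. 1)"
          by (intro landau_o.big.mult_in_1 y_bigo_1) simp
        from landau_o.big.mult[OF WW_bigo_square[of i k j] this] False True show ?thesis
          by (intro bigo_square_imp_smallo) simp
      qed
      then have a: "(\<lambda>s. ?P s (\<lambda>k. (d k - d i) * (y s $ k - x $ k))) \<in> o[at 0](\<lambda>s. s)"
        by (rule big_sum_in_smallo)
      have b: "(\<lambda>s. d i * (?P s (\<lambda>k. y s $ k - x $ k) - s * B $ i $ j)) \<in> o[at 0](\<lambda>s. s)"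
        using bigo_square_imp_smallo[OF eigenvalue_shift_same_block[OF True]] by (cases "d i = 0") auto
      show ?thesis
        using sum_in_smallo(1)[OF a b]
        by (simp add: sum_subtractf sum.distrib sum_distrib_left algebra_simps)
    qed
    have "(if i = j then \<Sum>l\<in>UNIV. H $ i $ l * B $ l $ l
             else (if x $ i = x $ j then d i else (D $ i - D $ j) / (x $ i - x $ j)) * B $ i $ j) =
          (if i = j then e i else 0) + d i * B $ i $ j"
      using True by (simp add: Hsum e_def)
    moreover have "(\<lambda>s. (?P s (\<lambda>k. D $ k) - (if i = j then D $ i else 0))
        + s * (?P s e - (if i = j then e i else 0))
        + (?P s (\<lambda>k. d k * (y s $ k - x $ k)) - s * (d i * B $ i $ j)) + ?P s (\<rho> s)) \<in> o[at 0](\<lambda>s. s)"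
      by (intro sum_in_smallo 1 2 3 P\<rho>)
    ultimately show ?thesis
      unfolding split by (simp add: algebra_simps)
  next
    case False
    have 1: "(\<lambda>s. ?P s (\<lambda>k. D $ k) - s * ((D $ i - D $ j) / (x $ i - x $ j) * B $ i $ j)) \<in> o[at 0](\<lambda>s. s)"
      by (rule bigo_square_imp_smallo[OF projection_different_block[OF D False]])
    have WW: "(\<lambda>s. W s $ i $ k * W s $ j $ k) \<in> O[at 0](\<lambda>s. s)" for k
      using False by (intro WW_bigo) auto
    have "(\<lambda>s. ?P s e) \<in> O[at 0](\<lambda>s. s)"
      using landau_o.big.mult[OF WW bigo_const] by (intro big_sum_in_bigo) simp
    then have "(\<lambda>s. s * ?P s e) \<in> O[at 0](\<lambda>s. s * s)"
      by (rule landau_o.big.mult[rotated]) simp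
    then have 2: "(\<lambda>s. s * ?P s e) \<in> o[at 0](\<lambda>s. s)"
      by (rule bigo_square_imp_smallo)
    have "(\<lambda>s. d k * (y s $ k - x $ k)) \<in> O[at 0](\<lambda>s. s)" for k
      using y_bigo by (cases "d k = 0") auto
    from landau_o.big.mult[OF WW this]
    have 3: "(\<lambda>s. ?P s (\<lambda>k. d k * (y s $ k - x $ k))) \<in> o[at 0](\<lambda>s. s)"
      by (intro big_sum_in_smallo bigo_square_imp_smallo)
    have "(\<lambda>s. (?P s (\<lambda>k. D $ k) - s * ((D $ i - D $ j) / (x $ i - x $ j) * B $ i $ j))
        + s * ?P s e + ?P s (\<lambda>k. d k * (y s $ k - x $ k)) + ?P s (\<rho> s)) \<in> o[at 0](\<lambda>s. s)"
      by (intro sum_in_smallo 1 2 3 P\<rho>)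
    moreover have "i \<noteq> j" using False by auto
    ultimately show ?thesis
      unfolding split using False by (simp add: algebra_simps)
  qed
qed

lemma line_diagonalisation:
  fixes x :: "real^'n" and B Q :: "real^'n^'n"
  assumes B: "symmetric_mat B" and Q: "orthogonal_matrix Q"
  obtains W y where "eigen_perturbation x (transpose Q ** B ** Q) W y"
    and "\<And>s. orthogonal_matrix (Q ** W s)"
    and "\<And>s. Q ** diag_mat x ** transpose Q + s *\<^sub>R B = (Q ** W s) ** diag_mat (y s) ** transpose (Q ** W s)"
proof -
  define B' where "B' = transpose Q ** B ** Q"
  have "symmetric_mat B'"
    using B by (simp add: B'_def symmetric_mat_def matrix_transpose_mul matrix_mul_assoc)
  then obtain C where C: "\<And>s. \<exists>W y. orthogonal_matrix W \<and>
      diag_mat x + s *\<^sub>R B' = W ** diag_mat y ** transpose W \<and>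
      (\<forall>i. \<bar>y $ i - x $ i\<bar> \<le> C * \<bar>s\<bar>) \<and> (\<forall>i k. \<bar>x $ i - x $ k\<bar> * \<bar>W $ i $ k\<bar> \<le> C * \<bar>s\<bar>)"
    using diagonal_perturbation by blast
  then obtain W y where W: "\<And>s. orthogonal_matrix (W s)"
    and diag: "\<And>s. diag_mat x + s *\<^sub>R B' = W s ** diag_mat (y s) ** transpose (W s)"
    and y: "\<And>s i. \<bar>y s $ i - x $ i\<bar> \<le> C * \<bar>s\<bar>"
    and gap: "\<And>s i k. \<bar>x $ i - x $ k\<bar> * \<bar>W s $ i $ k\<bar> \<le> C * \<bar>s\<bar>"
    by metis
  have "eigen_perturbation x B' W y"
  proof
    show "(\<lambda>s. y s $ i - x $ i) \<in> O[at 0](\<lambda>s. s)" for i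
      using y by (intro bigoI[of _ C]) simp
    show "(\<lambda>s. W s $ i $ k) \<in> O[at 0](\<lambda>s. s)" if "x $ i \<noteq> x $ k" for i k
      using gap[of i k] that by (intro bigoI[of _ "C / \<bar>x $ i - x $ k\<bar>"]) (simp add: field_simps)
  qed (use W diag in auto)
  moreover have "Q ** diag_mat x ** transpose Q + s *\<^sub>R B = (Q ** W s) ** diag_mat (y s) ** transpose (Q ** W s)" for s
  proof -
    have "Q ** B' ** transpose Q = B"
      using Q unfolding B'_def orthogonal_matrix_def
      by (metis matrix_mul_assoc matrix_mul_lid matrix_mul_rid)
    moreover have "Q ** (diag_mat x + s *\<^sub>R B') ** transpose Q = Q ** diag_mat x ** transpose Q + s *\<^sub>R (Q ** B' ** transpose Q)"
      by (simp add: vec_eq_iff matrix_matrix_mult_def sum.distrib sum_distrib_left sum_distrib_right algebra_simps)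
    ultimately show ?thesis
      by (simp add: diag matrix_transpose_mul matrix_mul_assoc)
  qed
  ultimately show thesis
    using that[of W y] orthogonal_matrix_mul[OF Q W] unfolding B'_def by blast
qed

subsection \<open>Derivatives of spectral functions\<close>

text \<open>A chain rule for curves that are merely O(s)-close to \<open>x\<close>, since the chosen
  eigenvalues need not be differentiable in \<open>s\<close>.\<close>

lemma has_derivative_along_curve:
  fixes h :: "real^'n \<Rightarrow> real" and y :: "real \<Rightarrow> real^'n"
  assumes h: "(h has_derivative h') (at x)"
    and y: "\<And>i. (\<lambda>s. y s $ i - x $ i) \<in> O[at 0](\<lambda>s. s)"
  shows "(\<lambda>s. h (y s) - h x - h' (y s - x)) \<in> o[at 0](\<lambda>s. s)"
proof (rule landau_o.smallI)
  fix c :: real assume "c > 0"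
  have "(\<lambda>s. \<Sum>i\<in>UNIV. \<bar>y s $ i - x $ i\<bar>) \<in> O[at 0](\<lambda>s. s)"
    using y by (intro big_sum_in_bigo) simp
  then obtain C where C: "C > 0" "\<forall>\<^sub>F s in at 0. norm (\<Sum>i\<in>UNIV. \<bar>y s $ i - x $ i\<bar>) \<le> C * norm s"
    by (elim landau_o.bigE)
  obtain d where d: "d > 0" "\<And>z. norm (z - x) < d \<Longrightarrow> norm (h z - h x - h' (z - x)) \<le> c / C * norm (z - x)"
    using h \<open>c > 0\<close> \<open>C > 0\<close> unfolding has_derivative_at_alt by (metis divide_pos_pos)
  have "\<forall>\<^sub>F s :: real in at 0. \<bar>s\<bar> < d / C"
    using d(1) C(1) by (auto simp: eventually_at intro!: exI[of _ "d / C"])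
  with C(2) show "\<forall>\<^sub>F s in at 0. norm (h (y s) - h x - h' (y s - x)) \<le> c * norm s"
  proof eventually_elim
    case (elim s)
    have *: "norm (y s - x) \<le> C * \<bar>s\<bar>"
      using norm_le_l1_cart[of "y s - x"] elim(1) by (simp add: sum_nonneg)
    also have "\<dots> < d"
      using elim(2) C(1) by (simp add: field_simps)
    finally have "norm (h (y s) - h x - h' (y s - x)) \<le> c / C * norm (y s - x)"
      by (rule d(2))
    also have "\<dots> \<le> c / C * (C * \<bar>s\<bar>)"
      using * \<open>c > 0\<close> C(1) by (intro mult_left_mono) auto
    finally show ?case using C(1) by simp
  qed
qed

lemma smallo_imp_has_real_derivative_at_0:
  assumes "(\<lambda>s. h s - h 0 - s * L) \<in> o[at 0](\<lambda>s. s)"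
  shows "(h has_real_derivative L) (at 0)"
proof -
  have "((\<lambda>s. (h s - h 0 - s * L) / s + L) \<longlongrightarrow> 0 + L) (at 0)"
    by (intro tendsto_add smalloD_tendsto[OF assms] tendsto_const)
  moreover have "\<forall>\<^sub>F s in at 0. (h s - h 0 - s * L) / s + L = (h (0 + s) - h 0) / s"
    by (auto simp: eventually_at_filter field_simps)
  ultimately show ?thesis
    unfolding DERIV_def by (simp add: Lim_transform_eventually)
qed

lemma open_pos_cone: "open (pos_cone :: (real^'n) set)"
proof -
  have eq: "pos_cone = (\<Inter>i. {x :: real^'n. 0 < x $ i})"
    by (auto simp: pos_cone_def)
  show ?thesis
    unfolding eq by (intro open_INT ballI open_Collect_less continuous_intros) simp
qed

lemma (in eigen_perturbation) y_tendsto: "(y \<longlongrightarrow> x) (at 0)"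
proof (rule vec_tendstoI)
  fix i
  have "(\<lambda>s. y s $ i - x $ i) \<in> o[at 0](\<lambda>_. 1 :: real)"
  proof (rule landau_o.big_small_trans[OF y_bigo])
    show "(\<lambda>s::real. s) \<in> o[at 0](\<lambda>_. 1 :: real)"
      by (rule smalloI_tendsto) (auto intro!: tendsto_eq_intros)
  qed
  from tendsto_add[OF smalloD_tendsto[OF this] tendsto_const[of "x $ i"]]
  show "((\<lambda>s. y s $ i) \<longlongrightarrow> x $ i) (at 0)" by simp
qed

lemma (in eigen_perturbation) eventually_pos_cone:
  assumes "x \<in> pos_cone"
  shows "\<forall>\<^sub>F s in at 0. y s \<in> pos_cone"
  using y_tendsto open_pos_cone assms by (rule topological_tendstoD)

section \<open>Symmetric functions and their first two derivatives\<close>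

abbreviation swap :: "'n \<Rightarrow> 'n \<Rightarrow> 'n \<Rightarrow> 'n" where
  "swap \<equiv> Transposition.transpose"

locale symmetric_C2 =
  fixes f :: "real^'n \<Rightarrow> real" and D :: "real^'n \<Rightarrow> real^'n" and H :: "real^'n \<Rightarrow> real^'n^'n"
  assumes sym: "symmetric_fun pos_cone f"
    and grad: "x \<in> pos_cone \<Longrightarrow> (f has_derivative (\<lambda>w. D x \<bullet> w)) (at x)"
    and hess: "x \<in> pos_cone \<Longrightarrow>
      ((\<lambda>x. D x $ k) has_derivative (\<lambda>w. \<Sum>l\<in>UNIV. H x $ k $ l * w $ l)) (at x)"
begin

lemma permuted_pos_cone: "x \<in> pos_cone \<Longrightarrow> (\<chi> k. x $ p k) \<in> pos_cone"
  by (simp add: pos_cone_def)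

text \<open>Differentiate the invariance of \<open>f\<close> under the swap of two coordinates and
  test the resulting identity on an axis vector.\<close>

lemma D_permute:
  assumes x: "x \<in> pos_cone"
  shows "D (\<chi> k. x $ swap i j k) $ k = D x $ swap i j k"
proof -
  let ?P = "\<lambda>x :: real^'n. \<chi> k. x $ swap i j k"
  have "(?P has_derivative ?P) (at x)"
    by (intro linear_imp_has_derivative linearI) (simp_all add: vec_eq_iff)
  from has_derivative_compose[OF this grad[OF permuted_pos_cone[OF x]]]
  have deriv: "((\<lambda>x. f (?P x)) has_derivative (\<lambda>w. D (?P x) \<bullet> ?P w)) (at x)" .
  have inv: "f (?P z) = f z" if "z \<in> pos_cone" for z
    using sym permutes_swap_id[of i UNIV j] that unfolding symmetric_fun_def by blast
  have "(f has_derivative (\<lambda>w. D (?P x) \<bullet> ?P w)) (at x)"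
    by (rule has_derivative_transform_within_open[OF deriv open_pos_cone x inv])
  from has_derivative_unique[OF this grad[OF x]]
  have "D (?P x) \<bullet> ?P w = D x \<bullet> w" for w
    by (rule fun_cong)
  moreover have "?P (axis (swap i j k) 1) = axis k 1"
    by (simp add: axis_def vec_eq_iff inj_eq[OF inj_on_transpose[of i j UNIV]])
  ultimately have "D (?P x) \<bullet> axis k 1 = D x \<bullet> axis (swap i j k) 1"
    by metis
  then show ?thesis by (simp add: inner_axis)
qed

lemma D_block:
  assumes x: "x \<in> pos_cone" and ij: "x $ i = x $ j"
  shows "D x $ i = D x $ j"
proof -
  have "(\<chi> k. x $ swap i j k) = x"
    using ij by (auto simp: vec_eq_iff Transposition.transpose_def)
  then show ?thesis
    using D_permute[OF x, of i j i] by simp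
qed

text \<open>The swap fixes \<open>x\<close>, so the identity of \<open>D_permute\<close>, valid on
  the whole cone, can be differentiated once more at \<open>x\<close> itself.\<close>

lemma H_swap:
  assumes x: "x \<in> pos_cone" and ij: "x $ i = x $ j"
  shows "H x $ swap i j k $ swap i j l = H x $ k $ l"
proof -
  let ?P = "\<lambda>x :: real^'n. \<chi> k. x $ swap i j k"
  have Px: "?P x = x"
    using ij by (auto simp: vec_eq_iff Transposition.transpose_def)
  have P: "(?P has_derivative ?P) (at x)"
    by (intro linear_imp_has_derivative linearI) (simp_all add: vec_eq_iff)
  have "((\<lambda>z. D z $ k) has_derivative (\<lambda>w. \<Sum>l\<in>UNIV. H x $ k $ l * w $ l)) (at (?P x))"
    using hess[OF x] by (simp add: Px)
  from has_derivative_compose[OF P this]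
  have "((\<lambda>z. D (?P z) $ k) has_derivative (\<lambda>w. \<Sum>l\<in>UNIV. H x $ k $ l * ?P w $ l)) (at x)" .
  then have "((\<lambda>z. D z $ swap i j k) has_derivative (\<lambda>w. \<Sum>l\<in>UNIV. H x $ k $ l * ?P w $ l)) (at x)"
    by (rule has_derivative_transform_within_open[OF _ open_pos_cone x D_permute])
  from has_derivative_unique[OF this hess[OF x]]
  have "(\<Sum>l\<in>UNIV. H x $ k $ l * ?P w $ l) = (\<Sum>l\<in>UNIV. H x $ swap i j k $ l * w $ l)" for w
    by (rule fun_cong)
  from this[of "axis (swap i j l) 1"] show ?thesis
    by (simp add: axis_def if_distrib inj_eq[OF inj_on_transpose[of i j UNIV]] cong: if_cong)
qed

text \<open>The coefficients \<open>g\<^sub>k\<^sub>l\<close>; for \<open>x\<^sub>k = x\<^sub>l\<close> this is the limit of the difference quotient.\<close>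

definition gap :: "real^'n \<Rightarrow> 'n \<Rightarrow> 'n \<Rightarrow> real" where
  "gap x k l = (if x $ k = x $ l then H x $ k $ k - H x $ k $ l else (D x $ k - D x $ l) / (x $ k - x $ l))"

text \<open>On a block of equal entries of \<open>x\<close>, permutation symmetry makes the Hessian a multiple of the
  identity plus a constant matrix.\<close>

lemma hessian_block_decomposition:
  assumes x: "x \<in> pos_cone"
  obtains K d where "\<And>k l. H x $ k $ l = K k l + (if k = l then d k else 0)"
    and "\<And>k k' l. x $ k = x $ k' \<Longrightarrow> K k l = K k' l"
    and "\<And>k l l'. x $ l = x $ l' \<Longrightarrow> K k l = K k l'"
    and "\<And>k l. x $ k = x $ l \<Longrightarrow> d k = d l"
    and "\<And>k l. k \<noteq> l \<Longrightarrow> x $ k = x $ l \<Longrightarrow> gap x k l = d k"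
proof -
  have gap_eq: "gap x k l = gap x k l'" if "k \<noteq> l" "k \<noteq> l'" "x $ k = x $ l" "x $ k = x $ l'" for k l l'
    using H_swap[OF x, of l l' k l] that by (simp add: gap_def)
  \<comment> \<open>On a block with a single index any value would do; 0 is taken.\<close>
  define d where "d k = (if \<exists>j. k \<noteq> j \<and> x $ k = x $ j then gap x k (SOME j. k \<noteq> j \<and> x $ k = x $ j) else 0)" for k
  have d: "gap x k l = d k" if "k \<noteq> l" "x $ k = x $ l" for k l
  proof -
    have ex: "\<exists>j. k \<noteq> j \<and> x $ k = x $ j" using that by metis
    from someI_ex[OF this] show ?thesis
      unfolding d_def if_P[OF ex] using gap_eq that by blast
  qed
  then have Hd: "H x $ k $ k - d k = H x $ k $ l" if "k \<noteq> l" "x $ k = x $ l" for k l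
    using that by (force simp: gap_def)
  define K where "K k l = H x $ k $ l - (if k = l then d k else 0)" for k l
  have dd: "d k = d l" if "x $ k = x $ l" for k l
  proof (cases "k = l")
    case False
    then show ?thesis
      using Hd[of k l] Hd[of l k] H_swap[OF x that, of k k] H_swap[OF x that, of k l] that by simp
  qed simp
  show thesis
  proof (rule that[OF _ _ _ dd d])
    show "H x $ k $ l = K k l + (if k = l then d k else 0)" for k l
      by (simp add: K_def)
    show "K k l = K k' l" if "x $ k = x $ k'" for k k' l
    proof (cases "k = k' \<or> l = k \<or> l = k'")
      case True
      then show ?thesis
        using Hd[of k k'] Hd[of k' k] H_swap[OF x that, of k k'] that by (auto simp: K_def)
    next
      case False
      then show ?thesis
        using H_swap[OF x that, of k l] by (auto simp: K_def)
    qed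
    show "K k l = K k l'" if "x $ l = x $ l'" for k l l'
    proof (cases "l = l' \<or> k = l \<or> k = l'")
      case True
      then show ?thesis
        using Hd[of l l'] Hd[of l' l] that by (auto simp: K_def)
    next
      case False
      then show ?thesis
        using H_swap[OF x that, of k l] by (auto simp: K_def)
    qed
  qed
qed

text \<open>The gradient of \<open>f\<close> is constant on blocks, so only block traces of the
  eigenvalue shift enter, and these are linear in \<open>s\<close> up to O(s^2) even if single
  eigenvalues behave badly.\<close>

lemma matF_has_derivative_on_line:
  fixes B Q :: "real^'n^'n"
  assumes x: "x \<in> pos_cone" and Q: "orthogonal_matrix Q" and B: "symmetric_mat B"
  shows "((\<lambda>s. matF f (Q ** diag_mat x ** transpose Q + s *\<^sub>R B)) has_real_derivative
    (\<Sum>k\<in>UNIV. D x $ k * (transpose Q ** B ** Q) $ k $ k)) (at 0)"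
proof -
  define B' where "B' = transpose Q ** B ** Q"
  obtain W y where "eigen_perturbation x B' W y" and QW: "\<And>s. orthogonal_matrix (Q ** W s)"
    and line: "\<And>s. Q ** diag_mat x ** transpose Q + s *\<^sub>R B = (Q ** W s) ** diag_mat (y s) ** transpose (Q ** W s)"
    by (rule line_diagonalisation[OF B Q, of x, folded B'_def]) (rule that)
  then interpret eigen_perturbation x B' W y by simp
  let ?F = "\<lambda>s. matF f (Q ** diag_mat x ** transpose Q + s *\<^sub>R B)"
  let ?L = "\<Sum>k\<in>UNIV. D x $ k * B' $ k $ k"
  have "(\<lambda>s. f (y s) - f x - D x \<bullet> (y s - x)) \<in> o[at 0](\<lambda>s. s)"
    by (rule has_derivative_along_curve[OF grad[OF x] y_bigo])
  moreover have "(\<lambda>s. D x \<bullet> (y s - x) - s * ?L) \<in> o[at 0](\<lambda>s. s)"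
    using bigo_square_imp_smallo[OF block_trace[OF D_block[OF x]]] by (simp add: inner_vec_def)
  ultimately have "(\<lambda>s. (f (y s) - f x - D x \<bullet> (y s - x)) + (D x \<bullet> (y s - x) - s * ?L)) \<in> o[at 0](\<lambda>s. s)"
    by (rule sum_in_smallo)
  moreover have "\<forall>\<^sub>F s in at 0. (f (y s) - f x - D x \<bullet> (y s - x)) + (D x \<bullet> (y s - x) - s * ?L) = ?F s - ?F 0 - s * ?L"
    using eventually_pos_cone[OF x]
  proof eventually_elim
    case (elim s)
    have "?F s = f (y s)"
      unfolding line by (rule matF_conjugate_diag_mat[OF sym elim QW])
    moreover have "?F 0 = f x"
      using matF_conjugate_diag_mat[OF sym x Q] by simp
    ultimately show ?case by simp
  qed
  ultimately have "(\<lambda>s. ?F s - ?F 0 - s * ?L) \<in> o[at 0](\<lambda>s. s)"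
    by (rule landau_o.small.in_cong[THEN iffD1, rotated])
  from smallo_imp_has_real_derivative_at_0[OF this] show ?thesis
    unfolding B'_def .
qed

text \<open>The symmetrisation inside \<open>dotF\<close> disappears because a matrix and its
  transpose have the same diagonal.\<close>

lemma dotF_conjugate_diag_mat:
  fixes Q M :: "real^'n^'n"
  assumes x: "x \<in> pos_cone" and Q: "orthogonal_matrix Q"
  shows "dotF f (Q ** diag_mat x ** transpose Q) M = (\<Sum>k\<in>UNIV. D x $ k * (transpose Q ** M ** Q) $ k $ k)"
proof -
  define S where "S = (1/2) *\<^sub>R (M + transpose M)"
  have "symmetric_mat S"
    by (simp add: symmetric_mat_nth S_def transpose_def)
  from matF_has_derivative_on_line[OF x Q this]
  have "dotF f (Q ** diag_mat x ** transpose Q) M = (\<Sum>k\<in>UNIV. D x $ k * (transpose Q ** S ** Q) $ k $ k)"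
    unfolding dotF_def S_def by (rule DERIV_imp_deriv)
  moreover have "(transpose Q ** S ** Q) $ k $ k = (transpose Q ** M ** Q) $ k $ k" for k
  proof -
    have "transpose Q ** transpose M ** Q = transpose (transpose Q ** M ** Q)"
      by (simp add: matrix_transpose_mul matrix_mul_assoc)
    then have "(transpose Q ** transpose M ** Q) $ k $ k = (transpose Q ** M ** Q) $ k $ k"
      by (simp only:) (simp add: transpose_def[of "_ ** _"])
    moreover have "transpose Q ** S ** Q = (1/2) *\<^sub>R (transpose Q ** M ** Q + transpose Q ** transpose M ** Q)"
      by (simp add: S_def vec_eq_iff matrix_matrix_mult_def sum.distrib sum_distrib_left sum_distrib_right
          sum_divide_distrib algebra_simps)
    ultimately show ?thesis by simp
  qed
  ultimately show ?thesis by simp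
qed

text \<open>For \<open>s\<close> near 0 the first-derivative formula applies at the diagonalisation
  of the perturbed matrix and pairs \<open>B'\<close> with the conjugated gradient \<open>P\<close>.
  Expanding \<open>P\<close> by \<open>second_order_expansion\<close> gives the derivative of
  \<open>deriv F\<close> at 0.\<close>

lemma ddotF_conjugate_diag_mat:
  fixes B Q :: "real^'n^'n"
  assumes x: "x \<in> pos_cone" and Q: "orthogonal_matrix Q" and B: "symmetric_mat B"
    and B': "B' = transpose Q ** B ** Q"
  shows "ddotF f (Q ** diag_mat x ** transpose Q) B =
    (\<Sum>i\<in>UNIV. \<Sum>j\<in>UNIV. H x $ i $ j * B' $ i $ i * B' $ j $ j) +
    (\<Sum>i\<in>UNIV. \<Sum>j\<in>UNIV. if i = j then 0 else gap x i j * (B' $ i $ j)\<^sup>2)"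
proof -
  obtain W y where "eigen_perturbation x B' W y" and QW: "\<And>s. orthogonal_matrix (Q ** W s)"
    and line: "\<And>s. Q ** diag_mat x ** transpose Q + s *\<^sub>R B = (Q ** W s) ** diag_mat (y s) ** transpose (Q ** W s)"
    by (rule line_diagonalisation[OF B Q, of x, folded B']) (rule that)
  then interpret eigen_perturbation x B' W y by simp
  obtain K d where Kd: "\<And>k l. H x $ k $ l = K k l + (if k = l then d k else 0)"
    "\<And>k k' l. x $ k = x $ k' \<Longrightarrow> K k l = K k' l"
    "\<And>k l l'. x $ l = x $ l' \<Longrightarrow> K k l = K k l'"
    "\<And>k l. x $ k = x $ l \<Longrightarrow> d k = d l"
    "\<And>k l. k \<noteq> l \<Longrightarrow> x $ k = x $ l \<Longrightarrow> gap x k l = d k"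
    by (rule hessian_block_decomposition[OF x]) (rule that)
  define F where "F = (\<lambda>s. matF f (Q ** diag_mat x ** transpose Q + s *\<^sub>R B))"
  define P where "P i j s = (\<Sum>k\<in>UNIV. W s $ i $ k * W s $ j $ k * D (y s) $ k)" for i j s
  define L where "L i j = (if i = j then \<Sum>l\<in>UNIV. H x $ i $ l * B' $ l $ l else gap x i j * B' $ i $ j)" for i j
  \<comment> \<open>Written as a double sum with a Kronecker delta, to match the shape of
    \<open>Fs\<close>.\<close>
  have F0: "deriv F 0 = (\<Sum>i\<in>UNIV. \<Sum>j\<in>UNIV. B' $ i $ j * (if i = j then D x $ i else 0))"
    using DERIV_imp_deriv[OF matF_has_derivative_on_line[OF x Q B]]
    by (simp add: F_def B' if_distrib mult.commute cong: if_cong)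
  have Fs: "\<forall>\<^sub>F s in at 0. deriv F s = (\<Sum>i\<in>UNIV. \<Sum>j\<in>UNIV. B' $ i $ j * P i j s)"
    using eventually_pos_cone[OF x]
  proof eventually_elim
    case (elim s)
    have "((\<lambda>h. matF f ((Q ** W s) ** diag_mat (y s) ** transpose (Q ** W s) + h *\<^sub>R B)) has_real_derivative
        (\<Sum>k\<in>UNIV. D (y s) $ k * (transpose (Q ** W s) ** B ** (Q ** W s)) $ k $ k)) (at 0)"
      by (rule matF_has_derivative_on_line[OF elim QW B])
    then have "((\<lambda>h. F (h + s)) has_real_derivative
        (\<Sum>k\<in>UNIV. D (y s) $ k * (transpose (Q ** W s) ** B ** (Q ** W s)) $ k $ k)) (at 0)"
      by (simp add: line[symmetric] F_def scaleR_left_distrib add_ac)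
    then have "deriv F s = (\<Sum>k\<in>UNIV. D (y s) $ k * (transpose (Q ** W s) ** B ** (Q ** W s)) $ k $ k)"
      using DERIV_shift[of F _ 0 s] by (simp add: DERIV_imp_deriv)
    also have "\<dots> = (\<Sum>k\<in>UNIV. D (y s) $ k * (transpose (W s) ** B' ** W s) $ k $ k)"
      by (simp add: B' matrix_transpose_mul matrix_mul_assoc)
    also have "\<dots> = (\<Sum>k\<in>UNIV. \<Sum>j\<in>UNIV. \<Sum>i\<in>UNIV. B' $ i $ j * (W s $ i $ k * W s $ j $ k * D (y s) $ k))"
      by (simp add: matrix_matrix_mult_def transpose_def sum_distrib_left sum_distrib_right mult_ac)
    also have "\<dots> = (\<Sum>k\<in>UNIV. \<Sum>i\<in>UNIV. \<Sum>j\<in>UNIV. B' $ i $ j * (W s $ i $ k * W s $ j $ k * D (y s) $ k))"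
      by (rule sum.cong[OF refl], rule sum.swap)
    also have "\<dots> = (\<Sum>i\<in>UNIV. \<Sum>k\<in>UNIV. \<Sum>j\<in>UNIV. B' $ i $ j * (W s $ i $ k * W s $ j $ k * D (y s) $ k))"
      by (rule sum.swap)
    also have "\<dots> = (\<Sum>i\<in>UNIV. \<Sum>j\<in>UNIV. \<Sum>k\<in>UNIV. B' $ i $ j * (W s $ i $ k * W s $ j $ k * D (y s) $ k))"
      by (rule sum.cong[OF refl], rule sum.swap)
    also have "\<dots> = (\<Sum>i\<in>UNIV. \<Sum>j\<in>UNIV. B' $ i $ j * P i j s)"
      by (simp add: P_def sum_distrib_left)
    finally show ?case .
  qed
  have "(\<lambda>s. P i j s - (if i = j then D x $ i else 0) - s * L i j) \<in> o[at 0](\<lambda>s. s)" for i j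
  proof -
    have "(\<lambda>s. D (y s) $ k - D x $ k - (\<Sum>l\<in>UNIV. H x $ k $ l * (y s $ l - x $ l))) \<in> o[at 0](\<lambda>s. s)" for k
      using has_derivative_along_curve[OF hess[OF x] y_bigo] by simp
    from second_order_expansion[OF this D_block[OF x] Kd(1-4)]
    have "(\<lambda>s. P i j s - (if i = j then D x $ i else 0)
      - s * (if i = j then \<Sum>l\<in>UNIV. H x $ i $ l * B' $ l $ l
             else (if x $ i = x $ j then d i else (D x $ i - D x $ j) / (x $ i - x $ j)) * B' $ i $ j))
      \<in> o[at 0](\<lambda>s. s)"
      unfolding P_def .
    moreover have "L i j = (if i = j then \<Sum>l\<in>UNIV. H x $ i $ l * B' $ l $ l
             else (if x $ i = x $ j then d i else (D x $ i - D x $ j) / (x $ i - x $ j)) * B' $ i $ j)"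
      using Kd(5)[of i j] by (simp add: L_def gap_def)
    ultimately show ?thesis by (simp only:)
  qed
  then have "(\<lambda>s. B' $ i $ j * (P i j s - (if i = j then D x $ i else 0) - s * L i j)) \<in> o[at 0](\<lambda>s. s)" for i j
    by (cases "B' $ i $ j = 0") auto
  then have "(\<lambda>s. \<Sum>i\<in>UNIV. \<Sum>j\<in>UNIV. B' $ i $ j * (P i j s - (if i = j then D x $ i else 0) - s * L i j)) \<in> o[at 0](\<lambda>s. s)"
    by (intro big_sum_in_smallo)
  moreover have "\<forall>\<^sub>F s in at 0. (\<Sum>i\<in>UNIV. \<Sum>j\<in>UNIV. B' $ i $ j * (P i j s - (if i = j then D x $ i else 0) - s * L i j))
      = deriv F s - deriv F 0 - s * (\<Sum>i\<in>UNIV. \<Sum>j\<in>UNIV. B' $ i $ j * L i j)"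
    using Fs
  proof eventually_elim
    case (elim s)
    show ?case
      unfolding elim F0 sum_distrib_left sum_subtractf[symmetric]
      by (intro sum.cong refl) (simp add: algebra_simps)
  qed
  ultimately have "(\<lambda>s. deriv F s - deriv F 0 - s * (\<Sum>i\<in>UNIV. \<Sum>j\<in>UNIV. B' $ i $ j * L i j)) \<in> o[at 0](\<lambda>s. s)"
    by (rule landau_o.small.in_cong[THEN iffD1, rotated])
  from DERIV_imp_deriv[OF smallo_imp_has_real_derivative_at_0[OF this]]
  have "ddotF f (Q ** diag_mat x ** transpose Q) B = (\<Sum>i\<in>UNIV. \<Sum>j\<in>UNIV. B' $ i $ j * L i j)"
    by (simp add: ddotF_def F_def)
  also have "\<dots> = (\<Sum>i\<in>UNIV. \<Sum>j\<in>UNIV. (if i = j then B' $ i $ i * (\<Sum>l\<in>UNIV. H x $ i $ l * B' $ l $ l) else 0)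
      + (if i = j then 0 else gap x i j * (B' $ i $ j)\<^sup>2))"
    by (intro sum.cong refl) (auto simp: L_def power2_eq_square)
  also have "\<dots> = (\<Sum>i\<in>UNIV. \<Sum>j\<in>UNIV. H x $ i $ j * B' $ i $ i * B' $ j $ j) +
    (\<Sum>i\<in>UNIV. \<Sum>j\<in>UNIV. if i = j then 0 else gap x i j * (B' $ i $ j)\<^sup>2)"
    by (simp add: sum.distrib sum_distrib_left mult_ac)
  finally show ?thesis .
qed

end

subsection \<open>Concavity and inverse-concavity\<close>

lemma bounded_linear_axis_expansion:
  fixes L :: "real^'n \<Rightarrow> real"
  assumes "bounded_linear L"
  shows "L w = (\<Sum>j\<in>UNIV. L (axis j 1) * w $ j)"
proof -
  interpret bounded_linear L by fact
  have "L w = L (\<Sum>j\<in>UNIV. (w $ j) *\<^sub>R axis j 1)"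
    using basis_expansion[of w] by (simp add: scalar_mult_eq_scaleR)
  then show ?thesis
    by (simp add: sum scaleR mult.commute)
qed

lemma smooth_symmetric_imp_symmetric_C2:
  fixes f :: "real^'n \<Rightarrow> real"
  assumes "smooth_on pos_cone f" and sym: "symmetric_fun pos_cone f"
  obtains D H where "symmetric_C2 f D H"
proof -
  have "Ck_on (Suc (Suc 0)) pos_cone f"
    using assms(1) by (auto simp: smooth_on_def)
  then have "\<exists>f'. (\<forall>x\<in>pos_cone. (f has_derivative f' x) (at x)) \<and>
      (\<forall>w. \<exists>g'. \<forall>x\<in>pos_cone. ((\<lambda>x. f' x w) has_derivative g' x) (at x))"
    unfolding Ck_on.simps by blast
  then obtain f' where f': "\<And>x. x \<in> pos_cone \<Longrightarrow> (f has_derivative f' x) (at x)"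
    and g: "\<forall>w. \<exists>g'. \<forall>x\<in>pos_cone. ((\<lambda>x. f' x w) has_derivative g' x) (at x)"
    by blast
  from g obtain g' where g': "\<And>x w. x \<in> pos_cone \<Longrightarrow> ((\<lambda>x. f' x w) has_derivative g' w x) (at x)"
    by metis
  have "symmetric_C2 f (\<lambda>x. \<chi> k. f' x (axis k 1)) (\<lambda>x. \<chi> k l. g' (axis k 1) x (axis l 1))"
  proof
    show "(f has_derivative (\<lambda>w. (\<chi> k. f' x (axis k 1)) \<bullet> w)) (at x)" if "x \<in> pos_cone" for x
    proof -
      have eq: "f' x w = (\<chi> k. f' x (axis k 1)) \<bullet> w" for w
        using bounded_linear_axis_expansion[OF has_derivative_bounded_linear[OF f'[OF that]], of w]
        by (simp add: inner_vec_def)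
      show ?thesis
        by (rule has_derivative_eq_rhs[OF f'[OF that] ext[OF eq]])
    qed
    show "((\<lambda>x. (\<chi> k. f' x (axis k 1)) $ k) has_derivative
        (\<lambda>w. \<Sum>l\<in>UNIV. (\<chi> k l. g' (axis k 1) x (axis l 1)) $ k $ l * w $ l)) (at x)"
      if "x \<in> pos_cone" for x k
    proof -
      have eq: "g' (axis k 1) x w = (\<Sum>l\<in>UNIV. g' (axis k 1) x (axis l 1) * w $ l)" for w
        using bounded_linear_axis_expansion[OF has_derivative_bounded_linear[OF g'[OF that]], of "axis k 1" w] .
      show ?thesis
        using has_derivative_eq_rhs[OF g'[OF that, of "axis k 1"] ext[OF eq]] by simp
    qed
  qed (rule sym)
  then show thesis by (rule that)
qed

lemma pos_cone_on_line:
  assumes "x \<in> (pos_cone :: (real^'n) set)"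
  shows "\<forall>\<^sub>F t in at (0::real). x + t *\<^sub>R w \<in> pos_cone"
proof -
  have "((\<lambda>t. x + t *\<^sub>R w) \<longlongrightarrow> x) (at 0)"
    by (auto intro!: tendsto_eq_intros)
  then show ?thesis
    using open_pos_cone assms by (rule topological_tendstoD)
qed

context symmetric_C2
begin

lemma has_real_derivative_on_line:
  assumes "x \<in> pos_cone"
  shows "((\<lambda>t. f (x + t *\<^sub>R w)) has_real_derivative D x \<bullet> w) (at 0)"
proof -
  have "((\<lambda>t. x + t *\<^sub>R w) has_derivative (\<lambda>t. t *\<^sub>R w)) (at 0)"
    by (auto intro!: derivative_eq_intros)
  moreover have "(f has_derivative (\<lambda>w. D x \<bullet> w)) (at (x + 0 *\<^sub>R w))"
    using grad[OF assms] by simp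
  ultimately have "((\<lambda>t. f (x + t *\<^sub>R w)) has_derivative (\<lambda>t. D x \<bullet> (t *\<^sub>R w))) (at 0)"
    by (rule has_derivative_compose)
  then show ?thesis
    by (simp add: has_field_derivative_def mult_commute_abs)
qed

lemma D_nonneg:
  assumes mono: "incr_each_arg pos_cone f" and x: "x \<in> pos_cone"
  shows "0 \<le> D x $ k"
proof -
  have "((\<lambda>t. (f (x + t *\<^sub>R axis k 1) - f (x + 0 *\<^sub>R axis k 1)) / t) \<longlongrightarrow> D x \<bullet> axis k 1) (at 0)"
    using has_real_derivative_on_line[OF x, of "axis k 1"] unfolding DERIV_def by simp
  then have "((\<lambda>t. (f (x + t *\<^sub>R axis k 1) - f x) / t) \<longlongrightarrow> D x $ k) (at_right 0)"
    using tendsto_mono[OF at_le[of "{0<..}" UNIV 0]] by (simp add: inner_axis)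
  moreover have "0 \<le> (f (x + t *\<^sub>R axis k 1) - f x) / t" if "t > 0" for t
  proof -
    have x1: "(\<chi> j. if j = k then x $ k else x $ j) = x"
      and xt: "(\<chi> j. if j = k then x $ k + t else x $ j) = x + t *\<^sub>R axis k 1"
      by (auto simp: vec_eq_iff axis_def)
    have "(\<chi> j. if j = k then x $ k + t else x $ j) \<in> pos_cone"
      using x that by (auto simp: pos_cone_def add_pos_pos)
    moreover have "(\<chi> j. if j = k then x $ k else x $ j) \<in> pos_cone" "x $ k \<le> x $ k + t"
      using x that by (auto simp: x1)
    ultimately have "f (\<chi> j. if j = k then x $ k else x $ j) \<le> f (\<chi> j. if j = k then x $ k + t else x $ j)"
      using mono x unfolding incr_each_arg_def by blast
    then show ?thesis
      using that unfolding x1 xt by simp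
  qed
  then have "\<forall>\<^sub>F t in at_right 0. 0 \<le> (f (x + t *\<^sub>R axis k 1) - f x) / t"
    by (simp add: eventually_at_filter)
  ultimately show ?thesis
    by (rule tendsto_lowerbound) simp
qed

section \<open>Consequences of concavity\<close>

context
  assumes concave: "concave_on pos_cone f"
begin

lemma tangent_above:
  assumes x: "x \<in> pos_cone" and z: "z \<in> pos_cone"
  shows "f z - f x \<le> D x \<bullet> (z - x)"
proof -
  have "((\<lambda>t. (f (x + t *\<^sub>R (z - x)) - f (x + 0 *\<^sub>R (z - x))) / t) \<longlongrightarrow> D x \<bullet> (z - x)) (at 0)"
    using has_real_derivative_on_line[OF x, of "z - x"] unfolding DERIV_def by simp
  then have "((\<lambda>t. (f (x + t *\<^sub>R (z - x)) - f x) / t) \<longlongrightarrow> D x \<bullet> (z - x)) (at_right 0)"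
    using tendsto_mono[OF at_le[of "{0<..}" UNIV 0]] by simp
  moreover have "f z - f x \<le> (f (x + t *\<^sub>R (z - x)) - f x) / t" if "0 < t" "t < 1" for t
  proof -
    have "(1 - t) * f x + t * f z \<le> f ((1 - t) *\<^sub>R x + t *\<^sub>R z)"
      using concave_onD[OF concave] that x z by simp
    also have "(1 - t) *\<^sub>R x + t *\<^sub>R z = x + t *\<^sub>R (z - x)"
      by (simp add: algebra_simps)
    finally show ?thesis
      using that by (simp add: field_simps)
  qed
  then have "\<forall>\<^sub>F t in at_right 0. f z - f x \<le> (f (x + t *\<^sub>R (z - x)) - f x) / t"
    using eventually_at_right_less[of 0] unfolding eventually_at_right_field
    by (auto intro!: exI[of _ 1])
  ultimately show ?thesis
    by (rule tendsto_lowerbound) simp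
qed

lemma D_antimono:
  assumes x: "x \<in> pos_cone" and z: "z \<in> pos_cone"
  shows "(D z - D x) \<bullet> (z - x) \<le> 0"
  using tangent_above[OF x z] tangent_above[OF z x] by (simp add: inner_simps)

lemma hessian_nonpos:
  assumes x: "x \<in> pos_cone"
  shows "(\<Sum>k\<in>UNIV. \<Sum>l\<in>UNIV. H x $ k $ l * w $ k * w $ l) \<le> 0"
proof -
  have "((\<lambda>t. D (x + t *\<^sub>R w) $ k) has_derivative (\<lambda>t. \<Sum>l\<in>UNIV. H x $ k $ l * (t *\<^sub>R w) $ l)) (at 0)" for k
  proof (rule has_derivative_compose[where f = "\<lambda>t. x + t *\<^sub>R w" and f' = "\<lambda>t. t *\<^sub>R w"])
    show "((\<lambda>t. x + t *\<^sub>R w) has_derivative (\<lambda>t. t *\<^sub>R w)) (at 0)"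
      by (auto intro!: derivative_eq_intros)
    show "((\<lambda>z. D z $ k) has_derivative (\<lambda>w. \<Sum>l\<in>UNIV. H x $ k $ l * w $ l)) (at (x + 0 *\<^sub>R w))"
      using hess[OF x] by simp
  qed
  then have "((\<lambda>t. D (x + t *\<^sub>R w) $ k) has_real_derivative (\<Sum>l\<in>UNIV. H x $ k $ l * w $ l)) (at 0)" for k
    unfolding has_field_derivative_def
    by (rule has_derivative_eq_rhs) (simp add: fun_eq_iff sum_distrib_left mult_ac)
  then have "((\<lambda>t. \<Sum>k\<in>UNIV. D (x + t *\<^sub>R w) $ k * w $ k) has_real_derivative
      (\<Sum>k\<in>UNIV. (\<Sum>l\<in>UNIV. H x $ k $ l * w $ l) * w $ k)) (at 0)"
    by (intro DERIV_sum DERIV_cmult_right)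
  then have "((\<lambda>t. (D (x + t *\<^sub>R w) \<bullet> w - D x \<bullet> w) / t) \<longlongrightarrow> (\<Sum>k\<in>UNIV. (\<Sum>l\<in>UNIV. H x $ k $ l * w $ l) * w $ k)) (at 0)"
    unfolding DERIV_def by (simp add: inner_vec_def)
  moreover have "\<forall>\<^sub>F t in at 0. (D (x + t *\<^sub>R w) \<bullet> w - D x \<bullet> w) / t \<le> 0"
    using pos_cone_on_line[OF x, of w]
  proof eventually_elim
    case (elim t)
    have "t * (D (x + t *\<^sub>R w) \<bullet> w - D x \<bullet> w) \<le> 0"
      using D_antimono[OF x elim] by (simp add: inner_simps)
    then show ?case
      by (auto simp: divide_le_0_iff mult_le_0_iff)
  qed
  ultimately have "(\<Sum>k\<in>UNIV. (\<Sum>l\<in>UNIV. H x $ k $ l * w $ l) * w $ k) \<le> 0"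
    by (rule tendsto_upperbound) simp
  then show ?thesis
    by (simp add: sum_distrib_left mult_ac)
qed

text \<open>For equal entries the Hessian on the difference of two axis vectors gives twice the gap.
  For distinct entries, apply antimonotonicity of the gradient to \<open>x\<close> and the point
  obtained by exchanging coordinates \<open>k\<close> and \<open>l\<close>.\<close>

lemma gap_nonpos:
  assumes x: "x \<in> pos_cone" and kl: "k \<noteq> l"
  shows "gap x k l \<le> 0"
proof (cases "x $ k = x $ l")
  case True
  define w :: "real^'n" where "w = (\<chi> i. (if i = k then 1 else 0) - (if i = l then 1 else 0))"
  have sum_w: "(\<Sum>i\<in>UNIV. c i * w $ i) = c k - c l" for c
    by (simp add: w_def right_diff_distrib sum_subtractf mult_delta_right)
  have "(\<Sum>i\<in>UNIV. \<Sum>j\<in>UNIV. H x $ i $ j * w $ i * w $ j) = (\<Sum>i\<in>UNIV. (\<Sum>j\<in>UNIV. H x $ i $ j * w $ j) * w $ i)"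
    by (simp add: sum_distrib_left mult_ac)
  also have "\<dots> = (H x $ k $ k - H x $ k $ l) + (H x $ l $ l - H x $ l $ k)"
    unfolding sum_w by simp
  also have "H x $ l $ l = H x $ k $ k"
    using H_swap[OF x True, of k k] by simp
  \<comment> \<open>Symmetry of this mixed derivative comes from the swap invariance at
    \<open>x\<close>.\<close>
  also have "H x $ l $ k = H x $ k $ l"
    using H_swap[OF x True, of k l] by simp
  finally show ?thesis
    using hessian_nonpos[OF x, of w] True by (simp add: gap_def)
next
  case False
  let ?z = "\<chi> i. x $ swap k l i"
  have z: "?z \<in> pos_cone" by (rule permuted_pos_cone[OF x])
  have "(D ?z - D x) \<bullet> (?z - x) = (\<Sum>i\<in>UNIV. (D x $ swap k l i - D x $ i) * (x $ swap k l i - x $ i))"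
    by (simp add: inner_vec_def D_permute[OF x])
  also have "\<dots> = (\<Sum>i\<in>{k, l}. (D x $ swap k l i - D x $ i) * (x $ swap k l i - x $ i))"
    by (rule sum.mono_neutral_right) auto
  also have "\<dots> = 2 * ((D x $ k - D x $ l) * (x $ k - x $ l))"
    using kl by (simp add: algebra_simps)
  finally have "(D x $ k - D x $ l) * (x $ k - x $ l) \<le> 0"
    using D_antimono[OF x z] by linarith
  then show ?thesis
    using False by (auto simp: gap_def divide_le_0_iff mult_le_0_iff)
qed

end

text \<open>Makes \<open>hessian_nonpos\<close> and \<open>gap_nonpos\<close> available for
  \<open>dual_fun f\<close>. The diagonal correction comes from the second derivative of the
  reciprocal and is the source of the lower bounds that follow.\<close>

lemma dual_symmetric_C2:
  "symmetric_C2 (dual_fun f)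
    (\<lambda>z. \<chi> i. D (\<chi> i. inverse (z $ i)) $ i * (inverse (z $ i))\<^sup>2)
    (\<lambda>z. \<chi> i j. - (H (\<chi> i. inverse (z $ i)) $ i $ j * (inverse (z $ i))\<^sup>2 * (inverse (z $ j))\<^sup>2)
       - (if i = j then 2 * D (\<chi> i. inverse (z $ i)) $ i * (inverse (z $ i))^3 else 0))"
proof
  let ?R = "\<lambda>z :: real^'n. \<chi> i. inverse (z $ i)"
  have R: "?R z \<in> pos_cone" if "z \<in> pos_cone" for z
    using that by (simp add: pos_cone_def)
  have inv: "((\<lambda>z. inverse (z $ i)) has_derivative (\<lambda>w. - ((inverse (z $ i))\<^sup>2 * w $ i))) (at z)"
    if "z \<in> pos_cone" for z i
  proof -
    have "z $ i \<noteq> 0" using that by (auto simp: pos_cone_def less_imp_neq[THEN not_sym])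
    from Deriv.has_derivative_inverse[OF this bounded_linear_imp_has_derivative[OF bounded_linear_vec_nth]]
    show ?thesis by (simp add: power2_eq_square mult_ac)
  qed
  have R': "(?R has_derivative (\<lambda>w. \<chi> i. - ((inverse (z $ i))\<^sup>2 * w $ i))) (at z)" if "z \<in> pos_cone" for z
    unfolding has_derivative_componentwise_within[of ?R]
    using inv[OF that] by (auto simp: Basis_vec_def inner_axis)
  show "symmetric_fun pos_cone (dual_fun f)"
    unfolding symmetric_fun_def
  proof (intro allI impI, elim conjE)
    fix \<sigma> :: "'n \<Rightarrow> 'n" and x :: "real^'n"
    assume "\<sigma> permutes UNIV" "x \<in> pos_cone"
    then have "f (\<chi> i. ?R x $ \<sigma> i) = f (?R x)"
      using sym R unfolding symmetric_fun_def by blast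
    then show "dual_fun f (\<chi> i. x $ \<sigma> i) = dual_fun f x"
      by (simp add: dual_fun_def)
  qed
  fix z :: "real^'n" assume z: "z \<in> pos_cone"
  have "((\<lambda>z. - f (?R z)) has_derivative (\<lambda>w. - (D (?R z) \<bullet> (\<chi> i. - ((inverse (z $ i))\<^sup>2 * w $ i))))) (at z)"
    by (intro has_derivative_minus has_derivative_compose[OF R'[OF z] grad[OF R[OF z]]])
  then show "(dual_fun f has_derivative (\<lambda>w. (\<chi> i. D (?R z) $ i * (inverse (z $ i))\<^sup>2) \<bullet> w)) (at z)"
    unfolding dual_fun_def by (simp add: inner_vec_def sum_negf mult_ac)
  fix i
  have 1: "((\<lambda>z. D (?R z) $ i) has_derivative (\<lambda>w. \<Sum>l\<in>UNIV. H (?R z) $ i $ l * (\<chi> i. - ((inverse (z $ i))\<^sup>2 * w $ i)) $ l)) (at z)"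
    by (rule has_derivative_compose[OF R'[OF z] hess[OF R[OF z]]])
  have 2: "((\<lambda>z. (inverse (z $ i))\<^sup>2) has_derivative (\<lambda>w. - (2 * (inverse (z $ i))^3 * w $ i))) (at z)"
    using has_derivative_mult[OF inv[OF z, of i] inv[OF z, of i]]
    by (simp add: power2_eq_square power3_eq_cube mult_ac)
  have "((\<lambda>z. D (?R z) $ i * (inverse (z $ i))\<^sup>2) has_derivative
      (\<lambda>w. \<Sum>l\<in>UNIV. (- (H (?R z) $ i $ l * (inverse (z $ i))\<^sup>2 * (inverse (z $ l))\<^sup>2)
       - (if i = l then 2 * D (?R z) $ i * (inverse (z $ i))^3 else 0)) * w $ l)) (at z)"
    by (rule has_derivative_eq_rhs[OF has_derivative_mult[OF 1 2]])
      (simp add: fun_eq_iff right_diff_distrib sum_subtractf sum_distrib_left mult_delta_right sum_negf mult_ac)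
  then show "((\<lambda>z. (\<chi> i. D (?R z) $ i * (inverse (z $ i))\<^sup>2) $ i) has_derivative
      (\<lambda>w. \<Sum>l\<in>UNIV. (\<chi> i j. - (H (?R z) $ i $ j * (inverse (z $ i))\<^sup>2 * (inverse (z $ j))\<^sup>2)
       - (if i = j then 2 * D (?R z) $ i * (inverse (z $ i))^3 else 0)) $ i $ l * w $ l)) (at z)"
    by simp
qed

section \<open>Lower bounds from inverse-concavity\<close>

context
  assumes dual_concave: "concave_on pos_cone (dual_fun f)"
begin

text \<open>This is \<open>hessian_nonpos\<close> for the dual function at the reciprocal point,
  rewritten in terms of \<open>f\<close>.\<close>

lemma hessian_ge:
  assumes x: "x \<in> pos_cone"
  shows "- 2 * (\<Sum>k\<in>UNIV. D x $ k * (w $ k)\<^sup>2 / x $ k) \<le> (\<Sum>k\<in>UNIV. \<Sum>l\<in>UNIV. H x $ k $ l * w $ k * w $ l)"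
proof -
  let ?z = "\<chi> i. inverse (x $ i)"
  have z: "?z \<in> pos_cone" using x by (simp add: pos_cone_def)
  have xp: "x $ i \<noteq> 0" for i using x by (auto simp: pos_cone_def less_imp_neq[THEN not_sym])
  \<comment> \<open>The test direction is rescaled so that the factors
    \<open>(x $ k)\<^sup>2\<close> from the chain rule cancel.\<close>
  let ?u = "\<chi> i. w $ i / (x $ i)\<^sup>2"
  have "(\<Sum>k\<in>UNIV. \<Sum>l\<in>UNIV. (- (H x $ k $ l * (x $ k)\<^sup>2 * (x $ l)\<^sup>2)
       - (if k = l then 2 * D x $ k * (x $ k)^3 else 0)) * ?u $ k * ?u $ l) \<le> 0"
    using symmetric_C2.hessian_nonpos[OF dual_symmetric_C2 dual_concave z, of ?u] by (simp cong: if_cong)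
  also have "(\<Sum>k\<in>UNIV. \<Sum>l\<in>UNIV. (- (H x $ k $ l * (x $ k)\<^sup>2 * (x $ l)\<^sup>2)
       - (if k = l then 2 * D x $ k * (x $ k)^3 else 0)) * ?u $ k * ?u $ l) =
     (\<Sum>k\<in>UNIV. \<Sum>l\<in>UNIV. - (H x $ k $ l * w $ k * w $ l) - (if k = l then 2 * (D x $ k * (w $ k)\<^sup>2 / x $ k) else 0))"
    using xp by (intro sum.cong refl) (auto simp: field_simps power2_eq_square power3_eq_cube)
  also have "\<dots> = - (\<Sum>k\<in>UNIV. \<Sum>l\<in>UNIV. H x $ k $ l * w $ k * w $ l) - 2 * (\<Sum>k\<in>UNIV. D x $ k * (w $ k)\<^sup>2 / x $ k)"
    by (simp add: sum_subtractf sum_negf sum_distrib_left)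
  finally show ?thesis by simp
qed

text \<open>This is \<open>gap_nonpos\<close> for the dual function at the reciprocal point. For
  equal entries \<open>D_block\<close> merges the two fractions.\<close>

lemma gap_ge:
  assumes x: "x \<in> pos_cone" and kl: "k \<noteq> l"
  shows "- (D x $ k / x $ l + D x $ l / x $ k) \<le> gap x k l"
proof -
  let ?z = "\<chi> i. inverse (x $ i)"
  have z: "?z \<in> pos_cone" using x by (simp add: pos_cone_def)
  have xp: "x $ i > 0" for i using x by (auto simp: pos_cone_def)
  note dual = symmetric_C2.gap_nonpos[OF dual_symmetric_C2 dual_concave z kl,
      unfolded symmetric_C2.gap_def[OF dual_symmetric_C2], simplified]
  show ?thesis
  proof (cases "x $ k = x $ l")
    case True
    have "- (H x $ k $ k * (x $ k)\<^sup>2 * (x $ k)\<^sup>2) - 2 * D x $ k * (x $ k)^3 + H x $ k $ l * (x $ k)\<^sup>2 * (x $ k)\<^sup>2 \<le> 0"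
      using dual True kl by simp
    then have "(x $ k)^3 * (x $ k * (H x $ k $ k - H x $ k $ l) + 2 * D x $ k) \<ge> 0"
      by (simp add: algebra_simps power2_eq_square power3_eq_cube)
    then have "x $ k * (H x $ k $ k - H x $ k $ l) + 2 * D x $ k \<ge> 0"
      using xp[of k] by (simp add: zero_le_mult_iff)
    then show ?thesis
      using True xp[of k] D_block[OF x True] by (simp add: gap_def field_simps)
  next
    case False
    \<comment> \<open>\<open>N / (inverse (x $ k) - inverse (x $ l))\<close> is the gap of the dual
      function. Replacing the difference of reciprocals by \<open>x $ k - x $ l\<close> flips the
      sign, so \<open>r\<close> is nonnegative.\<close>
    define N where "N = D x $ k * (x $ k)\<^sup>2 - D x $ l * (x $ l)\<^sup>2"
    define r where "r = N / (x $ k - x $ l)"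
    have "N / (inverse (x $ k) - inverse (x $ l)) \<le> 0"
      using dual False by (simp add: N_def)
    also have "N / (inverse (x $ k) - inverse (x $ l)) = - (x $ k * x $ l * r)"
      using xp[of k] xp[of l] False by (simp add: r_def divide_simps) (simp add: algebra_simps)
    finally have "0 \<le> r"
      using xp[of k] xp[of l] by (auto simp: zero_le_mult_iff mult_le_0_iff)
    then have "0 \<le> r / (x $ k * x $ l)"
      using xp[of k] xp[of l] by simp
    also have "\<dots> = gap x k l + (D x $ k / x $ l + D x $ l / x $ k)"
      using xp[of k] xp[of l] False by (simp add: gap_def N_def r_def divide_simps) (simp add: algebra_simps power2_eq_square)
    finally show ?thesis by simp
  qed
qed

end

end

subsection \<open>The pinching inequality in an eigenbasis\<close>

text \<open>The second derivative of \<open>matF\<close> in an eigenbasis, as computed by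
  \<open>ddotF_conjugate_diag_mat\<close>: \<open>h\<close> stands for the Hessian of
  \<open>f\<close> and \<open>g\<close> for the gaps.\<close>

definition spectral_form :: "('n::finite \<Rightarrow> 'n \<Rightarrow> real) \<Rightarrow> ('n \<Rightarrow> 'n \<Rightarrow> real) \<Rightarrow> ('n \<Rightarrow> 'n \<Rightarrow> real) \<Rightarrow> real" where
  "spectral_form h g S = (\<Sum>i\<in>UNIV. \<Sum>j\<in>UNIV. h i j * S i i * S j j)
     + (\<Sum>i\<in>UNIV. \<Sum>j\<in>UNIV. if i = j then 0 else g i j * (S i j)\<^sup>2)"

lemma spectral_form_scale:
  "spectral_form h g (\<lambda>i j. c * S i j) = c\<^sup>2 * spectral_form h g S"
  by (simp add: spectral_form_def distrib_left sum_distrib_left if_distrib power_mult_distrib power2_eq_square mult_ac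
      cong: if_cong)

text \<open>Isolates the data of \<open>f\<close> at the eigenvalues \<open>x\<close>:
  \<open>c\<close> is the gradient, \<open>h\<close> the Hessian, \<open>g\<close> the gaps. The
  index \<open>m\<close> is that of the basis vector \<open>v / |v|\<close>.\<close>

locale pinched_spectrum =
  fixes c x :: "'n::finite \<Rightarrow> real" and h g :: "'n \<Rightarrow> 'n \<Rightarrow> real" and m :: 'n and \<epsilon> :: real
  assumes h_nonpos: "(\<Sum>i\<in>UNIV. \<Sum>j\<in>UNIV. h i j * w i * w j) \<le> 0"
    and h_ge: "- 2 * (\<Sum>i\<in>UNIV. c i * (w i)\<^sup>2 / x i) \<le> (\<Sum>i\<in>UNIV. \<Sum>j\<in>UNIV. h i j * w i * w j)"
    and g_nonpos: "i \<noteq> j \<Longrightarrow> g i j \<le> 0"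
    and g_ge: "i \<noteq> j \<Longrightarrow> - (c i / x j + c j / x i) \<le> g i j"
    and g_eq: "x i \<noteq> x j \<Longrightarrow> g i j = (c i - c j) / (x i - x j)"
    and g_commute: "i \<noteq> j \<Longrightarrow> g i j = g j i"
    and c_nonneg: "0 \<le> c i"
    and c_block: "x i = x j \<Longrightarrow> c i = c j"
    and x_ge: "x m \<le> x i"
    and x_pos: "0 < x m"
    and \<epsilon>: "\<epsilon> = x m / (\<Sum>i\<in>UNIV. x i)" "\<epsilon> < 1"
begin

abbreviation "y i \<equiv> x i - x m"

lemma \<epsilon>_pos: "0 < \<epsilon>"
proof -
  have "x m \<le> (\<Sum>i\<in>UNIV. x i)"
    using x_ge x_pos by (intro member_le_sum) (auto intro: order_trans less_imp_le)
  then show ?thesis using x_pos by (simp add: \<epsilon>)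
qed

lemma spectral_form_le:
  assumes b: "b \<noteq> m"
  shows "spectral_form h g S \<le> g m b * ((S m b)\<^sup>2 + (S b m)\<^sup>2)"
proof -
  define F where "F i j = (if i = j then 0 else g i j * (S i j)\<^sup>2)" for i j
  have F: "F i j \<le> 0" for i j
    using g_nonpos[of i j] by (simp add: F_def mult_nonpos_nonneg)
  have "(\<Sum>i\<in>UNIV. \<Sum>j\<in>UNIV. F i j) = (\<Sum>p\<in>UNIV \<times> UNIV. F (fst p) (snd p))"
    by (simp add: sum.cartesian_product case_prod_beta)
  also have "\<dots> \<le> (\<Sum>p\<in>{(m, b), (b, m)}. F (fst p) (snd p))"
    using sum_mono2[of "UNIV \<times> UNIV" "{(m, b), (b, m)}" "\<lambda>p. - F (fst p) (snd p)"] F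
    by (simp add: sum_negf)
  also have "\<dots> = g m b * ((S m b)\<^sup>2 + (S b m)\<^sup>2)"
    using b g_commute[of m b] by (simp add: F_def algebra_simps)
  finally show ?thesis
    using h_nonpos[of "\<lambda>i. S i i"] by (simp add: spectral_form_def F_def)
qed

text \<open>Since \<open>y m = 0\<close>, the quotient by \<open>y m\<close> reads as 0 and only the
  summand \<open>k = m\<close> can be negative. The explicit value of \<open>g m k\<close> and
  \<open>y k \<le> x k\<close> leave a surplus \<open>\<epsilon> * c m * (X k)\<^sup>2 / y k\<close>
  in each other summand, which Cauchy-Schwarz shows to be enough.\<close>

lemma diagonal_part_nonneg:
  fixes X :: "'n \<Rightarrow> real"
  assumes X_m: "c m * (X m - \<epsilon> * (\<Sum>a\<in>UNIV. X a)) = 0"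
    and X_block: "\<And>a. a \<noteq> m \<Longrightarrow> x a = x m \<Longrightarrow> c a * X a = 0"
  shows "0 \<le> (\<Sum>k\<in>UNIV. c k * (X k)\<^sup>2 / y k - (1 - \<epsilon>) * (c k * (X k)\<^sup>2 / x k)
      - (if k = m then 0 else \<epsilon> * g m k * (X k)\<^sup>2))"
proof -
  define Z where "Z = (\<Sum>k\<in>UNIV - {m}. (X k)\<^sup>2 / y k)"
  have Z: "Z \<ge> 0"
    unfolding Z_def by (intro sum_nonneg divide_nonneg_nonneg) (auto simp: x_ge)
  have le: "\<epsilon> * (c m * ((X k)\<^sup>2 / y k)) \<le> c k * (X k)\<^sup>2 / y k - (1 - \<epsilon>) * (c k * (X k)\<^sup>2 / x k) - \<epsilon> * g m k * (X k)\<^sup>2"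
    if k: "k \<noteq> m" for k
  proof (cases "x k = x m")
    case True
    then have cX: "c k * (X k)\<^sup>2 = 0"
      using X_block[OF k True] by (auto simp: power2_eq_square)
    have "\<epsilon> * g m k * (X k)\<^sup>2 \<le> 0"
      using g_nonpos[of m k] \<epsilon>_pos k by (intro mult_nonpos_nonneg mult_nonneg_nonpos) auto
    then show ?thesis unfolding cX using True by simp
  next
    case False
    then have pos: "0 < y k" "y k \<le> x k" "0 < x k"
      using x_ge[of k] x_pos by auto
    have "(1 - \<epsilon>) * (c k * (X k)\<^sup>2 / x k) \<le> (1 - \<epsilon>) * (c k * (X k)\<^sup>2 / y k)"
      using pos c_nonneg \<epsilon>(2) by (intro mult_left_mono divide_left_mono) auto
    moreover have gk: "g m k = - ((c m - c k) / y k)"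
      using False g_eq[of m k] by (metis minus_diff_eq minus_divide_right)
    have "\<epsilon> * g m k * (X k)\<^sup>2 = \<epsilon> * (c k * (X k)\<^sup>2 / y k) - \<epsilon> * (c m * ((X k)\<^sup>2 / y k))"
      unfolding gk by (simp add: algebra_simps diff_divide_distrib)
    ultimately show ?thesis
      unfolding left_diff_distrib by linarith
  qed
  have "(1 - \<epsilon>) * (c m * (X m)\<^sup>2 / x m) \<le> \<epsilon> * (c m * Z)"
  proof (cases "c m = 0")
    case False
    define s where "s = (\<Sum>k\<in>UNIV - {m}. X k)"
    have total: "(\<Sum>a\<in>UNIV. X a) = X m + s"
      by (simp add: s_def sum.remove[of UNIV m])
    have "X m = \<epsilon> * X m + \<epsilon> * s"
      using X_m False unfolding total distrib_left[symmetric] by simp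
    then have Xm: "(1 - \<epsilon>) * X m = \<epsilon> * s"
      unfolding left_diff_distrib by linarith
    \<comment> \<open>\<open>Y\<close> is the total spread above the smallest eigenvalue. The trace
      is \<open>x m / \<epsilon>\<close>, and the n copies of \<open>x m\<close> subtracted from it
      are estimated by a single copy.\<close>
    define Y where "Y = (\<Sum>k\<in>UNIV - {m}. y k)"
    have "Y = (\<Sum>k\<in>UNIV. x k) - real CARD('n) * x m"
      by (simp add: Y_def sum.remove[of UNIV m x] sum_subtractf of_nat_diff algebra_simps)
    moreover have "(\<Sum>k\<in>UNIV. x k) = x m / \<epsilon>"
      using \<epsilon>(1) \<epsilon>_pos x_pos by (auto simp: field_simps)
    moreover have "x m \<le> real CARD('n) * x m"
      using x_pos by (simp add: Suc_leI)
    ultimately have "Y \<le> x m / \<epsilon> - x m"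
      by linarith
    then have "\<epsilon> * Y \<le> \<epsilon> * (x m / \<epsilon> - x m)"
      using \<epsilon>_pos by (intro mult_left_mono) auto
    then have Y: "\<epsilon> * Y \<le> (1 - \<epsilon>) * x m"
      using \<epsilon>_pos by (simp add: algebra_simps)
    \<comment> \<open>The factorisation survives \<open>y k = 0\<close>: then
      \<open>c k = c m\<close> is nonzero, so \<open>X_block\<close> forces
      \<open>X k = 0\<close>.\<close>
    have "s = (\<Sum>k\<in>UNIV - {m}. (X k / sqrt (y k)) * sqrt (y k))"
      unfolding s_def
    proof (intro sum.cong refl)
      fix k assume "k \<in> UNIV - {m}"
      then show "X k = (X k / sqrt (y k)) * sqrt (y k)"
        using X_block[of k] c_block[of k m] False by (cases "x k = x m") auto
    qed
    then have "s\<^sup>2 \<le> (\<Sum>k\<in>UNIV - {m}. (X k / sqrt (y k))\<^sup>2) * (\<Sum>k\<in>UNIV - {m}. (sqrt (y k))\<^sup>2)"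
      using Cauchy_Schwarz_ineq_sum by metis
    also have "\<dots> = Z * Y"
      using x_ge by (simp add: Z_def Y_def power_divide)
    finally have s: "s\<^sup>2 \<le> Z * Y" .
    have "(1 - \<epsilon>) * ((1 - \<epsilon>) * (X m)\<^sup>2) = (\<epsilon> * s)\<^sup>2"
      unfolding Xm[symmetric] by (simp add: power2_eq_square)
    also have "\<dots> \<le> \<epsilon> * Z * (\<epsilon> * Y)"
      using s \<epsilon>_pos by (simp add: power2_eq_square mult_ac)
    also have "\<dots> \<le> \<epsilon> * Z * ((1 - \<epsilon>) * x m)"
      using Y Z \<epsilon>_pos by (intro mult_left_mono) auto
    also have "\<dots> = (1 - \<epsilon>) * (\<epsilon> * Z * x m)"
      by simp
    finally have "(1 - \<epsilon>) * (X m)\<^sup>2 \<le> \<epsilon> * Z * x m"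
      using \<epsilon>(2) by simp
    then have "c m * ((1 - \<epsilon>) * (X m)\<^sup>2) \<le> c m * (\<epsilon> * Z * x m)"
      using c_nonneg by (rule mult_left_mono)
    then show ?thesis
      using x_pos by (simp add: field_simps)
  qed simp
  also have "\<epsilon> * (c m * Z) = (\<Sum>k\<in>UNIV - {m}. \<epsilon> * (c m * ((X k)\<^sup>2 / y k)))"
    by (simp add: Z_def sum_distrib_left)
  also have "\<dots> \<le> (\<Sum>k\<in>UNIV - {m}. c k * (X k)\<^sup>2 / y k - (1 - \<epsilon>) * (c k * (X k)\<^sup>2 / x k) - \<epsilon> * g m k * (X k)\<^sup>2)"
    by (intro sum_mono le) auto
  finally show ?thesis
    by (simp add: sum.remove[of UNIV m])
qed

text \<open>If neither eigenvalue is the smallest, \<open>g_ge\<close> suffices, as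
  \<open>y \<le> x\<close> enlarges the fractions. If exactly one is, the gap is explicit and the
  sum is a convex combination of \<open>c i\<close> and \<open>c j\<close> over a positive
  \<open>y\<close>. If both are, the fractions read as 0 and the hypotheses on \<open>t\<close> take
  over.\<close>

lemma off_diagonal_part_nonneg:
  assumes ij: "i \<noteq> j"
    and i: "x i = x m \<Longrightarrow> i \<noteq> m \<Longrightarrow> c j * t = 0"
    and j: "x j = x m \<Longrightarrow> j \<noteq> m \<Longrightarrow> c i * t = 0"
  shows "0 \<le> (1 - \<epsilon>) * (g i j * t\<^sup>2) + (c i / y j + c j / y i) * t\<^sup>2"
proof -
  have aux: "0 \<le> (1 - \<epsilon>) * (g i j * t\<^sup>2) + (c i / y j + c j / y i) * t\<^sup>2"
    if "i \<noteq> j" "x i = x m" "x j \<noteq> x m" for i j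
  proof -
    have pos: "y j > 0" using x_ge[of j] that by simp
    have g: "g i j = (c j - c i) / y j"
      using that g_eq[of i j] by (metis minus_diff_eq minus_divide_divide)
    have "(1 - \<epsilon>) * g i j + c i / y j = (\<epsilon> * c i + (1 - \<epsilon>) * c j) / y j"
      unfolding g times_divide_eq_right add_divide_distrib[symmetric] by (simp add: algebra_simps)
    moreover have "0 \<le> (\<epsilon> * c i + (1 - \<epsilon>) * c j) / y j"
      using pos c_nonneg \<epsilon>_pos \<epsilon>(2) by (intro divide_nonneg_pos add_nonneg_nonneg mult_nonneg_nonneg) auto
    ultimately have "0 \<le> (1 - \<epsilon>) * g i j + c i / y j" by (simp only:)
    from mult_nonneg_nonneg[OF this zero_le_power2[of t]] show ?thesis using that by (simp add: algebra_simps)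
  qed
  consider "x i = x m" "x j = x m" | "x i = x m" "x j \<noteq> x m" | "x i \<noteq> x m" "x j = x m" | "x i \<noteq> x m" "x j \<noteq> x m"
    by blast
  then show ?thesis
  proof cases
    case 1
    have "c i * t = 0"
      using ij i j 1 c_block[of i j] by metis
    \<comment> \<open>The upper and lower bounds on the gap squeeze it to 0; if instead
      \<open>c i\<close> is nonzero, then \<open>t = 0\<close>.\<close>
    moreover have "g i j = 0" if "c i = 0"
      using g_nonpos[OF ij] g_ge[OF ij] that c_block[of i j] 1 by simp
    ultimately show ?thesis
      using 1 by auto
  next
    case 2
    with aux ij show ?thesis by blast
  next
    case 3
    with aux[of j i] ij g_commute[OF ij] show ?thesis by (simp add: add.commute)
  next
    case 4
    then have pos: "0 < y i" "y i \<le> x i" "0 < y j" "y j \<le> x j" "0 < x i" "0 < x j"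
      using x_ge[of i] x_ge[of j] x_pos by auto
    have "- (c i / y j + c j / y i) \<le> - (c i / x j + c j / x i)"
      using pos c_nonneg by (intro le_imp_neg_le add_mono divide_left_mono) auto
    also have "\<dots> \<le> g i j" by (rule g_ge[OF ij])
    also have "g i j \<le> (1 - \<epsilon>) * g i j"
      using \<epsilon>_pos g_nonpos[OF ij] by (simp add: algebra_simps mult_nonneg_nonpos)
    finally have "0 \<le> ((1 - \<epsilon>) * g i j + (c i / y j + c j / y i)) * t\<^sup>2"
      by simp
    then show ?thesis by (simp add: algebra_simps)
  qed
qed

text \<open>The last term is the supremum over \<open>\<gamma>\<close> in the case where it is
  finite: \<open>z\<close> says that no linear term survives in a direction without a quadratic one.
  The estimate splits into the entries \<open>T m k k\<close> and the off-diagonal entries of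
  \<open>T m\<close>.\<close>

lemma pinching_nondegenerate:
  assumes T: "totally_symmetric T"
    and z: "\<And>k p. x p = x m \<Longrightarrow> c k * (T k p m - \<epsilon> * (\<Sum>a\<in>UNIV. T k a a) * (if p = m then 1 else 0)) = 0"
  shows "0 \<le> spectral_form h g (T m) - \<epsilon> * (\<Sum>b\<in>UNIV. spectral_form h g (T b))
    + 2 * (\<Sum>k\<in>UNIV. c k * (\<Sum>p\<in>UNIV. (T k p m)\<^sup>2 / y p))"
proof -
  have s1: "T i j k = T j i k" and s2: "T i j k = T i k j" for i j k
    using T by (auto simp: totally_symmetric_def)
  have s3: "T k p m = T m k p" for k p
    using s1 s2 by metis
  define X where "X k = T m k k" for k
  define e where "e k p = c k * ((T m k p)\<^sup>2 / y p)" for k p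
  define R where "R i j = (if i = j then 0 else (c i / y j + c j / y i) * (T m i j)\<^sup>2)" for i j
  define P where "P i j = (if i = j then 0 else g i j * (T m i j)\<^sup>2)" for i j
  \<comment> \<open>Symmetrising in the two indices pairs \<open>c i / y j\<close> with
    \<open>c j / y i\<close>, the combination that the gap bounds can control.\<close>
  have M: "2 * (\<Sum>k\<in>UNIV. c k * (\<Sum>p\<in>UNIV. (T k p m)\<^sup>2 / y p)) =
    2 * (\<Sum>k\<in>UNIV. c k * (X k)\<^sup>2 / y k) + (\<Sum>i\<in>UNIV. \<Sum>j\<in>UNIV. R i j)"
  proof -
    have "(\<Sum>k\<in>UNIV. c k * (\<Sum>p\<in>UNIV. (T k p m)\<^sup>2 / y p)) = (\<Sum>k\<in>UNIV. \<Sum>p\<in>UNIV. e k p)"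
      by (simp add: e_def sum_distrib_left s3)
    moreover have "(\<Sum>k\<in>UNIV. \<Sum>p\<in>UNIV. e k p) = (\<Sum>k\<in>UNIV. \<Sum>p\<in>UNIV. e p k)"
      by (rule sum.swap)
    ultimately have "2 * (\<Sum>k\<in>UNIV. c k * (\<Sum>p\<in>UNIV. (T k p m)\<^sup>2 / y p)) = (\<Sum>k\<in>UNIV. \<Sum>p\<in>UNIV. e k p + e p k)"
      by (simp add: sum.distrib)
    also have "\<dots> = (\<Sum>k\<in>UNIV. \<Sum>p\<in>UNIV. (if k = p then 2 * (c k * (X k)\<^sup>2 / y k) else 0) + R k p)"
    proof (intro sum.cong refl)
      fix k p
      have "T m p k = T m k p" by (rule s2)
      then show "e k p + e p k = (if k = p then 2 * (c k * (X k)\<^sup>2 / y k) else 0) + R k p"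
        by (simp add: e_def R_def X_def algebra_simps)
    qed
    also have "\<dots> = 2 * (\<Sum>k\<in>UNIV. c k * (X k)\<^sup>2 / y k) + (\<Sum>i\<in>UNIV. \<Sum>j\<in>UNIV. R i j)"
      by (simp add: sum.distrib sum_distrib_left)
    finally show ?thesis .
  qed
  have q_o: "spectral_form h g (T m) \<ge> - 2 * (\<Sum>k\<in>UNIV. c k * (X k)\<^sup>2 / x k) + (\<Sum>i\<in>UNIV. \<Sum>j\<in>UNIV. P i j)"
    using h_ge[of X] by (simp add: spectral_form_def P_def X_def)
  \<comment> \<open>Concavity is spent only on the slices \<open>b \<noteq> m\<close>. The slice
    \<open>b = m\<close> is merged with the leading form, which produces the factor
    \<open>1 - \<epsilon>\<close>.\<close>
  have "spectral_form h g (T b) \<le> 2 * (g m b * (X b)\<^sup>2)" if "b \<noteq> m" for b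
  proof -
    have "T b m b = X b" "T b b m = X b"
      using s1 s2 unfolding X_def by metis+
    then show ?thesis
      using spectral_form_le[OF that, of "T b"] by simp
  qed
  then have "(\<Sum>b\<in>UNIV - {m}. spectral_form h g (T b)) \<le> (\<Sum>b\<in>UNIV - {m}. 2 * (g m b * (X b)\<^sup>2))"
    by (intro sum_mono) auto
  also have "\<dots> = 2 * (\<Sum>k\<in>UNIV. if k = m then 0 else g m k * (X k)\<^sup>2)"
    by (simp add: sum.remove[of UNIV m] sum_distrib_left)
  finally have q_b: "\<epsilon> * (\<Sum>b\<in>UNIV - {m}. spectral_form h g (T b)) \<le> \<epsilon> * (2 * (\<Sum>k\<in>UNIV. if k = m then 0 else g m k * (X k)\<^sup>2))"
    using \<epsilon>_pos by (intro mult_left_mono) auto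
  have q_m: "(1 - \<epsilon>) * (- 2 * (\<Sum>k\<in>UNIV. c k * (X k)\<^sup>2 / x k) + (\<Sum>i\<in>UNIV. \<Sum>j\<in>UNIV. P i j)) \<le> (1 - \<epsilon>) * spectral_form h g (T m)"
    using q_o \<epsilon>(2) by (intro mult_left_mono) auto
  have "0 \<le> (\<Sum>k\<in>UNIV. c k * (X k)\<^sup>2 / y k - (1 - \<epsilon>) * (c k * (X k)\<^sup>2 / x k)
      - (if k = m then 0 else \<epsilon> * g m k * (X k)\<^sup>2))"
  proof (rule diagonal_part_nonneg)
    show "c m * (X m - \<epsilon> * (\<Sum>a\<in>UNIV. X a)) = 0"
      using z[of m m] by (simp add: X_def)
    show "c a * X a = 0" if "a \<noteq> m" "x a = x m" for a
      using z[of a a] that by (simp add: X_def s3)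
  qed
  also have "\<dots> = (\<Sum>k\<in>UNIV. c k * (X k)\<^sup>2 / y k) - (1 - \<epsilon>) * (\<Sum>k\<in>UNIV. c k * (X k)\<^sup>2 / x k)
      - \<epsilon> * (\<Sum>k\<in>UNIV. if k = m then 0 else g m k * (X k)\<^sup>2)"
    unfolding sum_distrib_left sum_subtractf[symmetric] by (intro sum.cong refl) auto
  finally have diag: "0 \<le> \<dots>" .
  moreover have "0 \<le> (\<Sum>i\<in>UNIV. \<Sum>j\<in>UNIV. (1 - \<epsilon>) * P i j + R i j)"
  proof (intro sum_nonneg)
    fix i j
    show "0 \<le> (1 - \<epsilon>) * P i j + R i j"
    proof (cases "i = j")
      case False
      have "c j * T m i j = 0" if "x i = x m" "i \<noteq> m"
        using z[of i j] that s2[of m i j] by (simp add: s3)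
      moreover have "c i * T m i j = 0" if "x j = x m" "j \<noteq> m"
        using z[of j i] that by (simp add: s3)
      ultimately show ?thesis
        using off_diagonal_part_nonneg[OF False, of "T m i j"] False by (simp add: P_def R_def)
    qed (simp add: P_def R_def)
  qed
  then have "0 \<le> (1 - \<epsilon>) * (\<Sum>i\<in>UNIV. \<Sum>j\<in>UNIV. P i j) + (\<Sum>i\<in>UNIV. \<Sum>j\<in>UNIV. R i j)"
    by (simp add: sum.distrib sum_distrib_left)
  moreover have "(\<Sum>b\<in>UNIV. spectral_form h g (T b)) = spectral_form h g (T m) + (\<Sum>b\<in>UNIV - {m}. spectral_form h g (T b))"
    by (simp add: sum.remove[of UNIV m])
  ultimately show ?thesis
    using q_b q_m diag unfolding M by (simp add: algebra_simps)
qed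

text \<open>A single \<open>\<gamma>\<close> with nonnegative value replaces the evaluation of a
  supremum: a zero of a nonconstant affine function in the unbounded case, the maximiser of the
  quadratic otherwise.\<close>

lemma pinching_inequality:
  assumes T: "totally_symmetric T"
  shows "\<exists>\<gamma>. 0 \<le> spectral_form h g (T m) - \<epsilon> * (\<Sum>b\<in>UNIV. spectral_form h g (T b))
    + 2 * (\<Sum>k\<in>UNIV. c k * (\<Sum>p\<in>UNIV. 2 * \<gamma> k p * (T k p m - \<epsilon> * (\<Sum>a\<in>UNIV. T k a a) * (if p = m then 1 else 0))
        - (\<gamma> k p)\<^sup>2 * y p))"
proof -
  define u where "u k p = T k p m - \<epsilon> * (\<Sum>a\<in>UNIV. T k a a) * (if p = m then 1 else 0)" for k p
  define V where "V = spectral_form h g (T m) - \<epsilon> * (\<Sum>b\<in>UNIV. spectral_form h g (T b))"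
  have "\<exists>\<gamma>. 0 \<le> V + 2 * (\<Sum>k\<in>UNIV. c k * (\<Sum>p\<in>UNIV. 2 * \<gamma> k p * u k p - (\<gamma> k p)\<^sup>2 * y p))"
  proof (cases "\<exists>k p. x p = x m \<and> c k * u k p \<noteq> 0")
    case True
    \<comment> \<open>the expression is unbounded above: it is linear in \<open>\<gamma> k p\<close>\<close>
    then obtain k p where kp: "x p = x m" "c k * u k p \<noteq> 0" by blast
    \<comment> \<open>Solves \<open>V + 4 * t * (c k * u k p) = 0\<close>, the value of the whole
      expression when \<open>t\<close> is the only entry of \<open>\<gamma>\<close>.\<close>
    define t where "t = - V / (4 * (c k * u k p))"
    define \<gamma> where "\<gamma> k' p' = (if k' = k then if p' = p then t else 0 else 0)" for k' p'
    have "c k' * (\<Sum>p'\<in>UNIV. 2 * \<gamma> k' p' * u k' p' - (\<gamma> k' p')\<^sup>2 * y p') = (if k' = k then 2 * t * (c k * u k p) else 0)" for k'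
    proof -
      have "(\<Sum>p'\<in>UNIV. 2 * \<gamma> k' p' * u k' p' - (\<gamma> k' p')\<^sup>2 * y p') = (\<Sum>p'\<in>UNIV. if p' = p then (if k' = k then 2 * t * u k p else 0) else 0)"
        using kp(1) by (intro sum.cong refl) (auto simp: \<gamma>_def)
      then show ?thesis by simp
    qed
    then have "V + 2 * (\<Sum>k\<in>UNIV. c k * (\<Sum>p\<in>UNIV. 2 * \<gamma> k p * u k p - (\<gamma> k p)\<^sup>2 * y p)) = V + 4 * t * (c k * u k p)"
      by simp
    also have "\<dots> = 0"
      using kp(2) by (simp add: t_def)
    finally show ?thesis by (intro exI[of _ \<gamma>]) (simp only: order_refl)
  next
    case False
    \<comment> \<open>The vertex of the parabola in each entry, equal to 0 by division by zero in
      the smallest block. Outside that block \<open>p \<noteq> m\<close>, so \<open>u k p\<close>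
      has no trace correction.\<close>
    define \<gamma> where "\<gamma> k p = u k p / y p" for k p
    have "2 * \<gamma> k p * u k p - (\<gamma> k p)\<^sup>2 * y p = (T k p m)\<^sup>2 / y p" for k p
      by (cases "x p = x m") (auto simp: \<gamma>_def u_def power2_eq_square)
    moreover have "0 \<le> V + 2 * (\<Sum>k\<in>UNIV. c k * (\<Sum>p\<in>UNIV. (T k p m)\<^sup>2 / y p))"
      unfolding V_def using False by (intro pinching_nondegenerate[OF T]) (auto simp: u_def)
    ultimately have "0 \<le> V + 2 * (\<Sum>k\<in>UNIV. c k * (\<Sum>p\<in>UNIV. 2 * \<gamma> k p * u k p - (\<gamma> k p)\<^sup>2 * y p))"
      by simp
    then show ?thesis by blast
  qed
  then show ?thesis unfolding V_def u_def .
qed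

end

subsection \<open>Rotation to the eigenbasis\<close>

lemma (in symmetric_C2) gap_commute:
  assumes "x \<in> pos_cone"
  shows "gap x k l = gap x l k"
proof (cases "x $ k = x $ l")
  case True
  then show ?thesis
    using H_swap[OF assms True, of k k] H_swap[OF assms True, of k l] by (simp add: gap_def)
next
  case False
  then show ?thesis
    by (simp add: gap_def) (metis minus_diff_eq minus_divide_divide)
qed

lemma scaleR_matrix_mult:
  fixes A :: "real^'n^'m" and B :: "real^'k^'n"
  shows "(c *\<^sub>R A) ** B = c *\<^sub>R (A ** B)" "A ** (c *\<^sub>R B) = c *\<^sub>R (A ** B)"
  by (simp_all add: vec_eq_iff matrix_matrix_mult_def sum_distrib_left mult_ac)

lemma orthogonal_matrix_inner_columns:
  fixes Q :: "real^'n^'n"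
  assumes Q: "orthogonal_matrix Q"
  shows "(\<Sum>b\<in>UNIV. (\<Sum>a\<in>UNIV. Q $ a $ b * r a) * (\<Sum>a\<in>UNIV. Q $ a $ b * s a)) = (\<Sum>a\<in>UNIV. r a * s a)"
proof -
  have "(transpose Q *v (\<chi> a. r a)) \<bullet> (transpose Q *v (\<chi> a. s a)) = (\<chi> a. r a) \<bullet> (\<chi> a. s a)"
    using Q by (metis dot_lmul_matrix matrix_vector_mul_assoc matrix_vector_mul_lid orthogonal_matrix_def
        transpose_matrix_vector)
  then show ?thesis
    by (simp add: inner_vec_def matrix_vector_mult_def transpose_def)
qed

lemma trace_conjugate_orthogonal:
  fixes Q :: "real^'n^'n"
  assumes "orthogonal_matrix Q"
  shows "trace (transpose Q ** M ** Q) = trace M"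
proof -
  have "trace (transpose Q ** M ** Q) = trace (Q ** (transpose Q ** M))"
    by (rule trace_mul_sym)
  then show ?thesis
    using assms by (simp add: matrix_mul_assoc orthogonal_matrix_def)
qed

text \<open>Coordinates of the tensor \<open>T\<close> with respect to the orthonormal basis of columns of \<open>Q\<close>.\<close>

definition rotate_tensor :: "real^'n^'n \<Rightarrow> ('n \<Rightarrow> 'n \<Rightarrow> 'n \<Rightarrow> real) \<Rightarrow> 'n \<Rightarrow> 'n \<Rightarrow> 'n \<Rightarrow> real" where
  "rotate_tensor Q T b i j = (\<Sum>a\<in>UNIV. Q $ a $ b * (transpose Q ** (\<chi> k l. T a k l) ** Q) $ i $ j)"

lemma rotate_tensor_eq:
  "rotate_tensor Q T b i j = (\<Sum>a\<in>UNIV. \<Sum>k\<in>UNIV. \<Sum>l\<in>UNIV. Q $ a $ b * Q $ k $ i * Q $ l $ j * T a k l)"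
proof -
  have "(transpose Q ** (\<chi> k l. T a k l) ** Q) $ i $ j = (\<Sum>k\<in>UNIV. \<Sum>l\<in>UNIV. Q $ k $ i * Q $ l $ j * T a k l)" for a
  proof -
    have "(transpose Q ** (\<chi> k l. T a k l) ** Q) $ i $ j = (\<Sum>l\<in>UNIV. \<Sum>k\<in>UNIV. Q $ k $ i * Q $ l $ j * T a k l)"
      by (simp add: matrix_matrix_mult_def transpose_def sum_distrib_left sum_distrib_right mult_ac)
    also have "\<dots> = (\<Sum>k\<in>UNIV. \<Sum>l\<in>UNIV. Q $ k $ i * Q $ l $ j * T a k l)"
      by (rule sum.swap)
    finally show ?thesis .
  qed
  then show ?thesis
    by (simp add: rotate_tensor_def sum_distrib_left mult_ac)
qed

lemma totally_symmetric_rotate_tensor: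
  assumes T: "totally_symmetric T"
  shows "totally_symmetric (rotate_tensor Q T)"
  unfolding totally_symmetric_def
proof (intro allI conjI)
  have s1: "T i j k = T j i k" and s2: "T i j k = T i k j" for i j k
    using T by (auto simp: totally_symmetric_def)
  fix i j k
  have "rotate_tensor Q T i j k = (\<Sum>b\<in>UNIV. \<Sum>a\<in>UNIV. \<Sum>l\<in>UNIV. Q $ a $ i * Q $ b $ j * Q $ l $ k * T a b l)"
    unfolding rotate_tensor_eq by (rule sum.swap)
  then show "rotate_tensor Q T i j k = rotate_tensor Q T j i k"
    unfolding rotate_tensor_eq by (simp add: mult_ac s1[of _ _])
  have "rotate_tensor Q T i j k = (\<Sum>a\<in>UNIV. \<Sum>l\<in>UNIV. \<Sum>b\<in>UNIV. Q $ a $ i * Q $ b $ j * Q $ l $ k * T a b l)"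
    unfolding rotate_tensor_eq by (rule sum.cong[OF refl], rule sum.swap)
  then show "rotate_tensor Q T i j k = rotate_tensor Q T i k j"
    unfolding rotate_tensor_eq by (simp add: mult_ac s2)
qed

text \<open>The two sides differ only by a rotation of the slice index. The form is a combination of
  products of two entries of one slice, and sums of such products over all slices are invariant
  under that rotation.\<close>

lemma sum_spectral_form_rotate:
  assumes "orthogonal_matrix Q"
  shows "(\<Sum>b\<in>UNIV. spectral_form h g (rotate_tensor Q T b)) =
    (\<Sum>a\<in>UNIV. spectral_form h g (\<lambda>i j. (transpose Q ** (\<chi> k l. T a k l) ** Q) $ i $ j))"
proof -
  define R where "R a i j = (transpose Q ** (\<chi> k l. T a k l) ** Q) $ i $ j" for a i j
  have *: "(\<Sum>b\<in>UNIV. rotate_tensor Q T b i j * rotate_tensor Q T b k l) = (\<Sum>a\<in>UNIV. R a i j * R a k l)" for i j k l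
    using orthogonal_matrix_inner_columns[OF assms] by (simp add: rotate_tensor_def R_def)
  have sum: "(\<Sum>b\<in>UNIV. spectral_form h g (S b)) = (\<Sum>i\<in>UNIV. \<Sum>j\<in>UNIV. h i j * (\<Sum>b\<in>UNIV. S b i i * S b j j))
      + (\<Sum>i\<in>UNIV. \<Sum>j\<in>UNIV. if i = j then 0 else g i j * (\<Sum>b\<in>UNIV. S b i j * S b i j))" for S :: "'a \<Rightarrow> 'a \<Rightarrow> 'a \<Rightarrow> real"
  proof -
    have swap: "(\<Sum>b\<in>UNIV. \<Sum>i\<in>UNIV. \<Sum>j\<in>UNIV. F b i j) = (\<Sum>i\<in>UNIV. \<Sum>j\<in>UNIV. \<Sum>b\<in>UNIV. F b i j)"
      for F :: "'a \<Rightarrow> 'a \<Rightarrow> 'a \<Rightarrow> real"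
      by (subst sum.swap) (rule sum.cong[OF refl], rule sum.swap)
    have "(\<Sum>b\<in>UNIV. spectral_form h g (S b)) = (\<Sum>b\<in>UNIV. \<Sum>i\<in>UNIV. \<Sum>j\<in>UNIV. h i j * S b i i * S b j j)
        + (\<Sum>b\<in>UNIV. \<Sum>i\<in>UNIV. \<Sum>j\<in>UNIV. if i = j then 0 else g i j * (S b i j)\<^sup>2)"
      by (simp add: spectral_form_def sum.distrib)
    also have "\<dots> = (\<Sum>i\<in>UNIV. \<Sum>j\<in>UNIV. \<Sum>b\<in>UNIV. h i j * S b i i * S b j j)
        + (\<Sum>i\<in>UNIV. \<Sum>j\<in>UNIV. \<Sum>b\<in>UNIV. if i = j then 0 else g i j * (S b i j)\<^sup>2)"
      by (rule arg_cong2[of _ _ _ _ "(+)", OF swap swap])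
    also have "\<dots> = (\<Sum>i\<in>UNIV. \<Sum>j\<in>UNIV. h i j * (\<Sum>b\<in>UNIV. S b i i * S b j j))
      + (\<Sum>i\<in>UNIV. \<Sum>j\<in>UNIV. if i = j then 0 else g i j * (\<Sum>b\<in>UNIV. S b i j * S b i j))"
      by (intro arg_cong2[of _ _ _ _ "(+)"] sum.cong refl) (auto simp: sum_distrib_left power2_eq_square mult_ac)
    finally show ?thesis .
  qed
  show ?thesis
    unfolding sum * R_def[symmetric] ..
qed

text \<open>The supremum lives in the extended reals because it may be infinite. The bound is
  obtained at one explicit array: the \<open>\<gamma>\<close> of \<open>pinching_inequality\<close>
  carried back from the eigenbasis, all terms scaling with the square of
  \<open>norm v\<close>.\<close>

theorem theorem4p1:
  fixes f :: "real^'n \<Rightarrow> real"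
    and A :: "real^'n^'n"
    and v :: "real^'n"
    and T :: "'n \<Rightarrow> 'n \<Rightarrow> 'n \<Rightarrow> real"
    and \<epsilon> :: real
  assumes f_smooth: "smooth_on pos_cone f"
    and f_sym: "symmetric_fun pos_cone f"
    and f_mono: "incr_each_arg pos_cone f"
    and f_concave: "concave_on pos_cone f"
    and f_inv_concave: "concave_on pos_cone (dual_fun f)"
    and A_pd: "pos_def A"
    and v_nz: "v \<noteq> 0"
    and v_eig: "\<exists>\<mu>. A *v v = \<mu> *\<^sub>R v \<and>
                    (\<forall>w c. w \<noteq> 0 \<and> A *v w = c *\<^sub>R w \<longrightarrow> \<mu> \<le> c)"
    and eps_def: "\<epsilon> = (v \<bullet> (A *v v)) / (trace A * (norm v)\<^sup>2)"
    and eps_pos: "0 < \<epsilon>"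
    and eps_lt: "\<epsilon> < 1 / real CARD('n)"
    and T_sym: "totally_symmetric T"
    and T_cond: "\<forall>k. (\<Sum>i\<in>UNIV. \<Sum>j\<in>UNIV. T i j k * v $ i * v $ j)
                     = \<epsilon> * (\<Sum>i\<in>UNIV. T i i k)"
  shows "ereal (ddotF f A (\<chi> k l. \<Sum>i\<in>UNIV. T i k l * v $ i)
               - \<epsilon> * (norm v)\<^sup>2 * (\<Sum>a\<in>UNIV. ddotF f A (\<chi> k l. T a k l)))
         + 2 * (SUP \<Gamma> :: 'n \<Rightarrow> 'n \<Rightarrow> real. ereal (dotF f A (\<chi> k l.
              2 * (\<Sum>p\<in>UNIV. \<Gamma> k p * ((\<Sum>i\<in>UNIV. T l p i * v $ i)
                                   - \<epsilon> * (\<Sum>a\<in>UNIV. T l a a) * v $ p))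
              - (\<Sum>p\<in>UNIV. \<Sum>q\<in>UNIV. \<Gamma> k p * \<Gamma> l q *
                   (A $ p $ q - \<epsilon> * trace A * (if p = q then 1 else 0))))))
         \<ge> 0"
proof -
  obtain \<mu> where \<mu>: "A *v v = \<mu> *\<^sub>R v" and \<mu>_le: "\<And>w c. w \<noteq> 0 \<Longrightarrow> A *v w = c *\<^sub>R w \<Longrightarrow> \<mu> \<le> c"
    using v_eig by blast
  define u where "u = (1 / norm v) *\<^sub>R v"
  have A_sym: "symmetric_mat A" and A_pos: "\<And>w. w \<noteq> 0 \<Longrightarrow> 0 < w \<bullet> (A *v w)"
    using A_pd by (auto simp: pos_def_def)
  have u: "norm u = 1" "A *v u = \<mu> *\<^sub>R u" and v: "v = norm v *\<^sub>R u"
    using v_nz \<mu> by (auto simp: u_def matrix_vector_mult_scaleR)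
  obtain Q x m where Q: "orthogonal_matrix Q" and A: "A = Q ** diag_mat x ** transpose Q" and m: "column m Q = u"
    using orthogonal_diagonalisation[OF A_sym u] by blast
  have vQ: "v $ i = norm v * Q $ i $ m" for i
    using m v by (metis column_def vec_lambda_beta vector_scaleR_component real_scaleR_def)
  have AQ: "A ** Q = Q ** diag_mat x"
    using Q unfolding A by (metis matrix_mul_assoc matrix_mul_rid orthogonal_matrix_def)
  have eigen: "A *v column k Q = x $ k *\<^sub>R column k Q" for k
  proof -
    have "(A *v column k Q) $ i = (A ** Q) $ i $ k" for i
      by (simp add: matrix_matrix_mult_def matrix_vector_mult_def column_def)
    then show ?thesis
      unfolding AQ by (simp add: vec_eq_iff diag_mat_mult_nth column_def mult.commute)
  qed
  have norm_col: "column k Q \<bullet> column k Q = 1" for k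
    using orthogonal_matrix_column_sum[OF Q, of k k] by (simp add: inner_vec_def column_def)
  then have col_nz: "column k Q \<noteq> 0" for k by (metis inner_zero_left zero_neq_one)
  have x: "x \<in> pos_cone"
    using A_pos[OF col_nz] by (simp add: pos_cone_def eigen norm_col)
  have xm: "x $ m = \<mu>"
    using eigen[of m] u col_nz[of m] unfolding m by (metis scaleR_cancel_right)
  have tr: "trace A = (\<Sum>i\<in>UNIV. x $ i)"
  proof -
    have "orthogonal_matrix (transpose Q)"
      using Q by (simp add: orthogonal_matrix_transpose)
    from trace_conjugate_orthogonal[OF this, of "diag_mat x"] have "trace A = trace (diag_mat x)"
      by (simp add: A)
    then show ?thesis by (simp add: trace_def diag_mat_def)
  qed
  have \<epsilon>_eq: "\<epsilon> = x $ m / (\<Sum>i\<in>UNIV. x $ i)"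
    using v_nz by (simp add: eps_def \<mu> xm tr power2_norm_eq_inner)
  obtain D H where "symmetric_C2 f D H"
    using smooth_symmetric_imp_symmetric_C2[OF f_smooth f_sym] by blast
  then interpret symmetric_C2 f D H .
  interpret pinched_spectrum "\<lambda>i. D x $ i" "\<lambda>i. x $ i" "\<lambda>i j. H x $ i $ j" "gap x" m \<epsilon>
  proof
    show "(\<Sum>i\<in>UNIV. \<Sum>j\<in>UNIV. H x $ i $ j * w i * w j) \<le> 0" for w
      using hessian_nonpos[OF f_concave x, of "\<chi> i. w i"] by simp
    show "- 2 * (\<Sum>i\<in>UNIV. D x $ i * (w i)\<^sup>2 / x $ i) \<le> (\<Sum>i\<in>UNIV. \<Sum>j\<in>UNIV. H x $ i $ j * w i * w j)" for w
      using hessian_ge[OF f_inv_concave x, of "\<chi> i. w i"] by simp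
    show "gap x i j = (D x $ i - D x $ j) / (x $ i - x $ j)" if "x $ i \<noteq> x $ j" for i j
      using that by (simp add: gap_def)
    have "1 / real CARD('n) \<le> 1" by (simp add: field_simps Suc_leI)
    then show "\<epsilon> < 1" using eps_lt by linarith
    show "0 < x $ m" using x by (simp add: pos_cone_def)
    show "x $ m \<le> x $ i" for i
      unfolding xm by (rule \<mu>_le[OF col_nz eigen])
    show "gap x i j \<le> 0" "- (D x $ i / x $ j + D x $ j / x $ i) \<le> gap x i j" if "i \<noteq> j" for i j
      using gap_nonpos[OF f_concave x that] gap_ge[OF f_inv_concave x that] by auto
    show "gap x i j = gap x j i" for i j
      by (rule gap_commute[OF x])
    show "0 \<le> D x $ i" for i
      by (rule D_nonneg[OF f_mono x])
    show "D x $ i = D x $ j" if "x $ i = x $ j" for i j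
      by (rule D_block[OF x that])
  qed (rule \<epsilon>_eq)
  define T' where "T' = rotate_tensor Q T"
  have T': "totally_symmetric T'"
    unfolding T'_def by (rule totally_symmetric_rotate_tensor[OF T_sym])
  have s1: "T i j k = T j i k" and s2: "T i j k = T i k j" for i j k
    using T_sym by (auto simp: totally_symmetric_def)
  have t1: "T' i j k = T' j i k" and t2: "T' i j k = T' i k j" for i j k
    using T' by (auto simp: totally_symmetric_def)
  let ?q = "spectral_form (\<lambda>i j. H x $ i $ j) (gap x)"
  have ddotF: "ddotF f A B = ?q (\<lambda>i j. (transpose Q ** B ** Q) $ i $ j)" if "symmetric_mat B" for B
    unfolding A by (simp add: ddotF_conjugate_diag_mat[OF x Q that refl] spectral_form_def)
  define B where "B = (\<chi> k l. \<Sum>i\<in>UNIV. T i k l * v $ i)"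
  have lin: "linear (\<lambda>M. transpose Q ** M ** Q)"
    by (rule linearI)
      (simp_all add: vec_eq_iff matrix_matrix_mult_def sum.distrib sum_distrib_left sum_distrib_right algebra_simps)
  \<comment> \<open>Contraction with \<open>v\<close> is contraction with \<open>norm v\<close>
    times the basis vector \<open>m\<close>, hence a multiple of the slice \<open>m\<close> of the
    rotated tensor.\<close>
  have B: "(transpose Q ** B ** Q) $ i $ j = norm v * T' m i j" for i j
  proof -
    have "B = (\<Sum>a\<in>UNIV. v $ a *\<^sub>R (\<chi> k l. T a k l))"
      by (simp add: B_def vec_eq_iff mult.commute)
    then have "transpose Q ** B ** Q = (\<Sum>a\<in>UNIV. v $ a *\<^sub>R (transpose Q ** (\<chi> k l. T a k l) ** Q))"
      by (simp only: linear_sum[OF lin] linear_cmul[OF lin])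
    then show ?thesis
      by (simp add: vQ T'_def rotate_tensor_def sum_distrib_left mult_ac)
  qed
  define \<tau> where "\<tau> l = (\<Sum>a\<in>UNIV. T l a a)" for l
  have \<tau>: "(\<Sum>l\<in>UNIV. Q $ l $ k * \<tau> l) = (\<Sum>a\<in>UNIV. T' k a a)" for k
  proof -
    have "(\<Sum>a\<in>UNIV. T' k a a) = (\<Sum>l\<in>UNIV. Q $ l $ k * trace (transpose Q ** (\<chi> i j. T l i j) ** Q))"
      unfolding T'_def rotate_tensor_def trace_def sum_distrib_left by (rule sum.swap)
    then show ?thesis
      by (simp add: trace_conjugate_orthogonal[OF Q]) (simp add: trace_def \<tau>_def)
  qed
  obtain \<gamma> where \<gamma>: "0 \<le> ?q (T' m) - \<epsilon> * (\<Sum>b\<in>UNIV. ?q (T' b))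
    + 2 * (\<Sum>k\<in>UNIV. D x $ k * (\<Sum>p\<in>UNIV. 2 * \<gamma> k p * (T' k p m - \<epsilon> * (\<Sum>a\<in>UNIV. T' k a a) * (if p = m then 1 else 0))
        - (\<gamma> k p)\<^sup>2 * (x $ p - x $ m)))"
    using pinching_inequality[OF T'] by blast
  define w where "w k = (\<Sum>p\<in>UNIV. 2 * \<gamma> k p * (T' k p m - \<epsilon> * (\<Sum>a\<in>UNIV. T' k a a) * (if p = m then 1 else 0))
        - (\<gamma> k p)\<^sup>2 * (x $ p - x $ m))" for k
  define g :: "real^'n^'n" where "g = (\<chi> k p. \<gamma> k p)"
  \<comment> \<open>The maximising array in the original coordinates. The factor
    \<open>norm v\<close> gives the linear and the quadratic term the same homogeneity in
    \<open>v\<close>.\<close>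
  define G where "G = norm v *\<^sub>R (Q ** g ** transpose Q)"
  \<comment> \<open>The coefficient matrix of the part linear in \<open>\<Gamma>\<close>.\<close>
  define E where "E = B - \<epsilon> *\<^sub>R (\<chi> l p. \<tau> l * v $ p)"
  define M :: "real^'n^'n" where "M = (\<chi> k l. 2 * (\<Sum>p\<in>UNIV. G $ k $ p * ((\<Sum>i\<in>UNIV. T l p i * v $ i) - \<epsilon> * \<tau> l * v $ p))
      - (\<Sum>p\<in>UNIV. \<Sum>q\<in>UNIV. G $ k $ p * G $ l $ q * (A $ p $ q - \<epsilon> * trace A * (if p = q then 1 else 0))))"
  have U: "(transpose Q ** E ** Q) $ k $ p = norm v * (T' k p m - \<epsilon> * (\<Sum>a\<in>UNIV. T' k a a) * (if p = m then 1 else 0))" for k p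
  proof -
    have "(transpose Q ** (\<chi> l p. \<tau> l * v $ p) ** Q) $ k $ p = (\<Sum>l\<in>UNIV. Q $ l $ k * \<tau> l) * (\<Sum>i\<in>UNIV. v $ i * Q $ i $ p)"
      by (simp add: matrix_matrix_mult_def transpose_def sum_distrib_left sum_distrib_right mult_ac)
    also have "(\<Sum>i\<in>UNIV. v $ i * Q $ i $ p) = norm v * (\<Sum>i\<in>UNIV. Q $ i $ m * Q $ i $ p)"
      by (simp add: vQ sum_distrib_left mult_ac)
    finally have "(transpose Q ** (\<chi> l p. \<tau> l * v $ p) ** Q) $ k $ p = norm v * ((\<Sum>a\<in>UNIV. T' k a a) * (if p = m then 1 else 0))"
      by (auto simp: \<tau> orthogonal_matrix_column_sum[OF Q])
    moreover have "T' m k p = T' k p m"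
      by (rule trans[OF t1 t2])
    ultimately show ?thesis
      by (simp add: E_def linear_diff[OF lin] linear_cmul[OF lin] B algebra_simps)
  qed
  \<comment> \<open>The shifted matrix \<open>A - \<epsilon> tr A\<close> in the eigenbasis, where
    \<open>\<epsilon> tr A\<close> equals the smallest eigenvalue \<open>x $ m\<close>.\<close>
  define N where "N = diag_mat (\<chi> p. x $ p - x $ m)"
  have \<epsilon>tr: "\<epsilon> * trace A = x $ m"
    using \<epsilon>_pos unfolding tr \<epsilon>_eq by auto
  have AN: "A $ p $ q - \<epsilon> * trace A * (if p = q then 1 else 0) = (Q ** N ** transpose Q) $ p $ q" for p q
  proof -
    have "(Q ** N ** transpose Q) $ p $ q = (\<Sum>k\<in>UNIV. Q $ p $ k * x $ k * Q $ q $ k) - x $ m * (\<Sum>k\<in>UNIV. Q $ p $ k * Q $ q $ k)"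
      unfolding N_def conjugate_diag_mat_nth by (simp add: sum_subtractf sum_distrib_left algebra_simps)
    moreover have "A $ p $ q = (\<Sum>k\<in>UNIV. Q $ p $ k * x $ k * Q $ q $ k)"
      by (simp add: A conjugate_diag_mat_nth)
    ultimately show ?thesis
      by (simp only: \<epsilon>tr orthogonal_matrix_row_sum[OF Q])
  qed
  have M: "M = 2 *\<^sub>R (G ** transpose E) - G ** (Q ** N ** transpose Q) ** transpose G"
  proof -
    have "(\<Sum>p\<in>UNIV. G $ k $ p * ((\<Sum>i\<in>UNIV. T l p i * v $ i) - \<epsilon> * \<tau> l * v $ p)) = (G ** transpose E) $ k $ l" for k l
    proof -
      have "T l p i = T i l p" for p i by (rule trans[OF s2 s1])
      then show ?thesis
        by (simp add: matrix_matrix_mult_def transpose_def E_def B_def mult.assoc)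
    qed
    moreover have "(\<Sum>p\<in>UNIV. \<Sum>q\<in>UNIV. G $ k $ p * G $ l $ q * R $ p $ q) = (G ** R ** transpose G) $ k $ l"
      for R :: "real^'n^'n" and k l
    proof -
      have "(\<Sum>p\<in>UNIV. \<Sum>q\<in>UNIV. G $ k $ p * G $ l $ q * R $ p $ q) = (\<Sum>q\<in>UNIV. \<Sum>p\<in>UNIV. G $ k $ p * G $ l $ q * R $ p $ q)"
        by (rule sum.swap)
      then show ?thesis
        by (simp add: matrix_matrix_mult_def transpose_def sum_distrib_left sum_distrib_right mult_ac)
    qed
    ultimately show ?thesis
      unfolding M_def AN by (simp add: vec_eq_iff)
  qed
  have QG: "transpose Q ** G = norm v *\<^sub>R (g ** transpose Q)"
    using Q unfolding G_def orthogonal_matrix_def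
    by (metis matrix_mul_assoc matrix_mul_lid scaleR_matrix_mult(2))
  have "transpose Q ** M ** Q = 2 *\<^sub>R (transpose Q ** (G ** transpose E) ** Q) - transpose Q ** (G ** (Q ** N ** transpose Q) ** transpose G) ** Q"
    unfolding M by (simp only: linear_diff[OF lin] linear_cmul[OF lin])
  also have "transpose Q ** (G ** transpose E) ** Q = (transpose Q ** G) ** transpose E ** Q"
    by (simp add: matrix_mul_assoc)
  also have "\<dots> = norm v *\<^sub>R (g ** transpose (transpose Q ** E ** Q))"
    unfolding QG by (simp add: matrix_transpose_mul matrix_mul_assoc scaleR_matrix_mult)
  also have "transpose Q ** (G ** (Q ** N ** transpose Q) ** transpose G) ** Q = (transpose Q ** G) ** Q ** N ** transpose ((transpose Q ** G) ** Q)"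
    by (simp add: matrix_transpose_mul matrix_mul_assoc)
  also have "(transpose Q ** G) ** Q = norm v *\<^sub>R g"
    using Q unfolding QG orthogonal_matrix_def
    by (metis matrix_mul_assoc matrix_mul_rid scaleR_matrix_mult(1))
  finally have QMQ: "transpose Q ** M ** Q = 2 *\<^sub>R (norm v *\<^sub>R (g ** transpose (transpose Q ** E ** Q)))
      - (norm v *\<^sub>R g) ** N ** transpose (norm v *\<^sub>R g)" .
  \<comment> \<open>The first derivative sees only the diagonal, on which the expression decouples
    into the rows of \<open>\<gamma>\<close>.\<close>
  have diag: "(transpose Q ** M ** Q) $ k $ k = (norm v)\<^sup>2 * w k" for k
  proof -
    have 1: "(g ** transpose (transpose Q ** E ** Q)) $ k $ k = (\<Sum>p\<in>UNIV. \<gamma> k p * (transpose Q ** E ** Q) $ k $ p)"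
      unfolding matrix_matrix_mult_def[of g] by (simp add: g_def transpose_def[of "_ ** _"])
    have 2: "((norm v *\<^sub>R g) ** N ** transpose (norm v *\<^sub>R g)) $ k $ k = (\<Sum>p\<in>UNIV. (norm v)\<^sup>2 * ((\<gamma> k p)\<^sup>2 * (x $ p - x $ m)))"
      unfolding N_def conjugate_diag_mat_nth by (simp add: g_def power2_eq_square mult_ac)
    have "(transpose Q ** M ** Q) $ k $ k = (\<Sum>p\<in>UNIV. 2 * (norm v * (\<gamma> k p * (transpose Q ** E ** Q) $ k $ p)))
        - (\<Sum>p\<in>UNIV. (norm v)\<^sup>2 * ((\<gamma> k p)\<^sup>2 * (x $ p - x $ m)))"
      unfolding QMQ by (simp add: 1 2 sum_distrib_left mult.assoc)
    then show ?thesis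
      unfolding U w_def sum_subtractf[symmetric] sum_distrib_left[of "(norm v)\<^sup>2"]
      by (elim trans) (intro sum.cong refl, simp add: power2_eq_square algebra_simps)
  qed
  have dotF: "dotF f A M = (norm v)\<^sup>2 * (\<Sum>k\<in>UNIV. D x $ k * w k)"
    unfolding A dotF_conjugate_diag_mat[OF x Q] diag sum_distrib_left
    by (intro sum.cong refl mult.left_commute)
  define V where "V = ddotF f A B - \<epsilon> * (norm v)\<^sup>2 * (\<Sum>a\<in>UNIV. ddotF f A (\<chi> k l. T a k l))"
  have V: "V = (norm v)\<^sup>2 * (?q (T' m) - \<epsilon> * (\<Sum>b\<in>UNIV. ?q (T' b)))"
  proof -
    have "symmetric_mat B" "symmetric_mat (\<chi> k l. T a k l)" for a
      using s2 by (auto simp: symmetric_mat_nth B_def)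
    then show ?thesis
      unfolding V_def T'_def sum_spectral_form_rotate[OF Q]
      by (simp add: ddotF B spectral_form_scale algebra_simps flip: T'_def)
  qed
  have "0 \<le> V + 2 * dotF f A M"
  proof -
    have "0 \<le> (norm v)\<^sup>2 * (?q (T' m) - \<epsilon> * (\<Sum>b\<in>UNIV. ?q (T' b))
    + 2 * (\<Sum>k\<in>UNIV. D x $ k * w k))"
      using \<gamma>[folded w_def] by (rule mult_nonneg_nonneg[OF zero_le_power2])
    then show ?thesis
      unfolding V dotF by (simp only: distrib_left mult.left_commute[of 2])
  qed
  then have "0 \<le> ereal V + 2 * ereal (dotF f A M)"
    by simp
  also have "\<dots> \<le> ereal V + 2 * (SUP \<Gamma> :: 'n \<Rightarrow> 'n \<Rightarrow> real. ereal (dotF f A (\<chi> k l.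
              2 * (\<Sum>p\<in>UNIV. \<Gamma> k p * ((\<Sum>i\<in>UNIV. T l p i * v $ i)
                                   - \<epsilon> * (\<Sum>a\<in>UNIV. T l a a) * v $ p))
              - (\<Sum>p\<in>UNIV. \<Sum>q\<in>UNIV. \<Gamma> k p * \<Gamma> l q *
                   (A $ p $ q - \<epsilon> * trace A * (if p = q then 1 else 0))))))"
    by (intro add_left_mono ereal_mult_left_mono SUP_upper2[of "\<lambda>k p. G $ k $ p"])
      (simp_all add: M_def \<tau>_def)
  finally show ?thesis
    unfolding V_def B_def .
qed

end
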